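(* Assume the following, for $n\ge M$. (1) Each $S_i$, $1\le i\le M$, is connected and $\delta=\min_{1\le i<j\le M}\min\{\|x-y\|:(x,y)\in S_i\times S_j\}>0$. (2) There is $\kappa_0>0$ such that $\mathbb P_0(A)\le\kappa_0\mathcal H^D(A)$ for all $A\subseteq S_0$. (3) For each $i\in\{1,\dots,M\}$ there is $\kappa_i>0$ such that $\mathbb P_i(A)\ge\kappa_i^{-1}\mathcal H^{s_i}(A)$ for all $A\subseteq S_i$. (4) There is $\kappa_c\ge1$ such that for all $i\in\{1,\dots,M\}$, $x\in S_i$ and $0<r\le\Delta_i$: $\kappa_c^{-1}\le \mathcal H^{s_i}(S_i\cap B(x,r))/(\eta(s_i)r^{s_i})\le\kappa_c$. (5) For each $i\in\{1,\dots,M\}$, $s_i=\lim_{r\to0}\log(N_r(S_i))/\log(1/r)$. (6) $\gamma^*<2\gamma_*$ and $0\le\varepsilon<\bar\gamma/(1+\bar\gamma)$. Then there exist two universal constants $C_1$ and $C_2$ such that the following propositions hold: 1. (Few outliers) If $\varepsilon=\exp(-n)$, then $\mathcal R_n(\mathcal X(\widehat r_n))\le C_1 n\exp(-C_2 n)$. 2. (Small dimensions of the supports) If $D>d+1$, then $\mathcal R_n(\mathcal X(\widehat r_n))\le C_1 n\exp(-C_2 n^{1/(d+1)})$. 3. (Large dimensions of the supports with few outliers) If $d\le D\le d+1$ and $\varepsilon=n^{-\beta}$ with $\beta\ge 1-D/(d+1)$, then $\mathcal R_n(\mathcal X(\widehat r_n))\le C_1 n^{d/(d+1)}\exp(-C_2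 n^{1/(d+1)})$. 4. (Large dimensions of the supports with many outliers) If $d\le D\le d+1$ and $\varepsilon=n^{-\beta}$ with $0<\beta<1-D/(d+1)$, then $\mathcal R_n(\mathcal X(\widehat r_n))\le C_1 n^{(1-\beta)d/D}\exp(-C_2 n^{1+(\beta-1)d/D})$.
   Context: Model. $D\ge1$, $M\ge 2$ and $n\ge1$ are integers and $\|\cdot\|$ is the Euclidean norm. $X_1,\dots,X_n$ are independent $[0,1]^D$-valued random variables with common law $\mathbb P=\varepsilon\mathbb P_0+(1-\varepsilon)\sum_{i=1}^M\gamma_i\mathbb P_i$, where $0\le\varepsilon<1$, $\gamma_i\ge0$, $\sum_{i=1}^M\gamma_i=1$, and $\mathbb P_0,\dots,\mathbb P_M$ are probability measures on $[0,1]^D$. The proportion of outliers $\varepsilon$ may vary with $n$; all other parameters of the model are kept fixed. For $1\le i\le M$, $S_i=\operatorname{supp}(\mathbb P_i)$ (a compact set), and $S_0=[0,1]^D\setminus\bigcup_{i=1}^M S_i$. It is assumed that $\operatorname{supp}(\mathbb P_0)\subseteq\overline{S_0}$ (closure) and $\mathbb P_0(\overline{S_0}\cap S_i)=0$ for $1\le i\le M$. Write $\mathbb X_n=\{X_1,\dots,X_n\}$ (sizes of subsets of the sample are counted with multiplicity). The symbol $\mathbb P$ is also used for the probability of events on the sample. Notation. $\mathcal H^s$ is the $s$-dimensional Hausdorff outer measure ($\mathcal H^D$ being Lebesgue measure on $\mathbb R^D$); $s_i$ is the Hausdorff dimension of $S_i$ and $d=\max_{1\le i\le M}s_i$; $\Delta_i$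 is the diameter of $S_i$; $B(x,r)$ is the Euclidean ball of center $x$ and radius $r$; $\eta(s)=\pi^{s/2}/\Gamma(1+s/2)$; $N_r(S_i)$ is the minimal number of open balls of radius $r$ needed to cover $S_i$; $\gamma_*=\min_{1\le i\le M}\gamma_i$, $\gamma^*=\max_{1\le i\le M}\gamma_i$, $\bar\gamma=\gamma_*-\gamma^*/2$. Clusters. For $r\ge0$ let $\mathcal Y_1(r),\dots,\mathcal Y_{M(r)}(r)$ be the connected components of the graph on the observations joining $X_k$ and $X_l$ when $\|X_k-X_l\|\le r$. They are indexed by decreasing size, ties being broken by declaring larger the cluster containing the smallest observation index. Set $\mathcal X_m(r)=\mathcal Y_m(r)$ for $1\le m\le \min(M,M(r))$, $\mathcal X_m(r)=\emptyset$ for $M(r)<m\le M$, and $\mathcal X(r)=\{\mathcal X_1(r),\dots,\mathcal X_M(r)\}$. Selected radius. Let $0=\rho_0<\rho_1<\dots<\rho_K$ be the successive radii at which the partition $\{\mathcal Y_m(r)\}_m$ changes as $r$ increases from $0$ ($\rho_K$ being the radius from which all observations form a single cluster). Then $\widehat r_n=\max\operatorname{argmax}_{\rho\in\{\rho_0,\dots,\rho_{K-1}\}}|\mathcal X_M(\rho)|$ (with $\widehat r_n=0$ if $K=0$). Clustering risk. For a (possibly random) radius $r$, with $\Pi_M$ the set of permutations of $\{1,\dots,M\}$, $$\mathcal R_n(\mathcal X(r))=\mathbb P\bigl(\forall\pi\in\Pi_M,\ \exists i\in\{1,\dots,M\},\ \mathbb X_n\cap S_i\nsubseteq\mathcal X_{\pi(i)}(r)\bigr).$$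 *)

theory Defs
  imports "HOL-Probability.Probability"
begin

section \<open>Hausdorff measure and dimension\<close>

text \<open>
  Every \<open>U\<close> in a cover contributes \<open>\<eta>(s) (diam U / 2)^s\<close> with \<open>\<eta> =\<close> \<^const>\<open>unit_ball_vol\<close>,
  the normalisation for which the \<open>D\<close>-dimensional measure on \<open>\<real>\<^sup>D\<close> is Lebesgue measure. The case
  \<open>s = 0\<close> (counting measure) is separate because \<open>0 powr 0 = 0\<close> in HOL.
\<close>

definition hausdorff_gauge :: "real \<Rightarrow> 'a::metric_space set \<Rightarrow> ennreal" where
  "hausdorff_gauge s U =
     (if U = {} then 0
      else if s = 0 then 1
      else ennreal (unit_ball_vol s * (diameter U / 2) powr s))"

text \<open>Boundedness is required because \<^const>\<open>diameter\<close> is unspecified on unbounded sets.\<close>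

definition hausdorff_premeasure :: "real \<Rightarrow> real \<Rightarrow> 'a::metric_space set \<Rightarrow> ennreal" where
  "hausdorff_premeasure s e A =
     (INF U \<in> {U :: nat \<Rightarrow> 'a set.
                 A \<subseteq> (\<Union>k. U k) \<and> (\<forall>k. bounded (U k) \<and> diameter (U k) \<le> e)}.
        \<Sum>k. hausdorff_gauge s (U k))"

definition hausdorff_measure :: "real \<Rightarrow> 'a::metric_space set \<Rightarrow> ennreal" where
  "hausdorff_measure s A = (SUP e\<in>{0<..}. hausdorff_premeasure s e A)"

definition hausdorff_dim :: "'a::metric_space set \<Rightarrow> real" where
  "hausdorff_dim A = Inf {s. 0 \<le> s \<and> hausdorff_measure s A = 0}"

definition covering_number :: "real \<Rightarrow> 'a::metric_space set \<Rightarrow> nat" where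
  "covering_number r A = (LEAST k. \<exists>C. finite C \<and> card C = k \<and> A \<subseteq> (\<Union>x\<in>C. ball x r))"

section \<open>The mixture model\<close>

definition unit_cube :: "(real ^ 'd) set" where
  "unit_cube = {x. \<forall>i. 0 \<le> x $ i \<and> x $ i \<le> 1}"

definition measure_support :: "'a::topological_space measure \<Rightarrow> 'a set" where
  "measure_support \<mu> = {x. \<forall>U. open U \<and> x \<in> U \<longrightarrow> 0 < emeasure \<mu> U}"

definition cube_distribution :: "(real ^ 'd) measure \<Rightarrow> bool" where
  "cube_distribution \<mu> \<longleftrightarrow> prob_space \<mu> \<and> sets \<mu> = sets borel \<and> measure \<mu> unit_cube = 1"

definition mixture_prob ::
    "real \<Rightarrow> nat \<Rightarrow> (nat \<Rightarrow> real) \<Rightarrow> (nat \<Rightarrow> 'a measure) \<Rightarrow> 'a set \<Rightarrow> real" where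
  "mixture_prob \<epsilon> M \<gamma> P A =
     \<epsilon> * measure (P 0) A + (1 - \<epsilon>) * (\<Sum>i=1..M. \<gamma> i * measure (P i) A)"

definition mixture_sample ::
    "'w measure \<Rightarrow> (nat \<Rightarrow> 'w \<Rightarrow> real ^ 'd) \<Rightarrow> nat \<Rightarrow>
     real \<Rightarrow> nat \<Rightarrow> (nat \<Rightarrow> real) \<Rightarrow> (nat \<Rightarrow> (real ^ 'd) measure) \<Rightarrow> bool" where
  "mixture_sample \<Omega> X n \<epsilon> M \<gamma> P \<longleftrightarrow>
     prob_space \<Omega> \<and>
     prob_space.indep_vars \<Omega> (\<lambda>_. borel) X {1..n} \<and>
     (\<forall>k\<in>{1..n}. \<forall>\<omega>\<in>space \<Omega>. X k \<omega> \<in> unit_cube) \<and>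
     (\<forall>k\<in>{1..n}. \<forall>A\<in>sets borel.
        measure (distr \<Omega> borel (X k)) A = mixture_prob \<epsilon> M \<gamma> P A)"

section \<open>Clusters of a sample\<close>

text \<open>
  A sample is \<open>x 1, \<dots>, x n\<close>, and a cluster is the set of the indices of its observations, so that
  \<^const>\<open>card\<close> counts observations with multiplicity. Coinciding observations share a cluster at
  every radius \<open>r \<ge> 0\<close>.
\<close>

definition neighbour_graph :: "nat \<Rightarrow> (nat \<Rightarrow> 'a::real_normed_vector) \<Rightarrow> real \<Rightarrow> (nat \<times> nat) set"
  where
  "neighbour_graph n x r = {(k, l). k \<in> {1..n} \<and> l \<in> {1..n} \<and> norm (x k - x l) \<le> r}"

definition clusters :: "nat \<Rightarrow> (nat \<Rightarrow> 'a::real_normed_vector) \<Rightarrow> real \<Rightarrow> nat set set" where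
  "clusters n x r = {1..n} // (neighbour_graph n x r)\<^sup>*"

definition larger_cluster :: "nat set \<Rightarrow> nat set \<Rightarrow> bool" where
  "larger_cluster C C' \<longleftrightarrow> card C' < card C \<or> (card C' = card C \<and> Min C < Min C')"

text \<open>The \<open>m\<close>-th largest cluster for \<open>m \<ge> 1\<close>, empty when there are fewer than \<open>m\<close> clusters.\<close>

definition ranked_cluster ::
    "nat \<Rightarrow> (nat \<Rightarrow> 'a::real_normed_vector) \<Rightarrow> real \<Rightarrow> nat \<Rightarrow> nat set" where
  "ranked_cluster n x r m =
     (if 1 \<le> m \<and> m \<le> card (clusters n x r)
      then THE C. C \<in> clusters n x r \<and> card {C' \<in> clusters n x r. larger_cluster C' C} = m - 1
      else {})"

section \<open>The selected radius\<close>

text \<open>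
  The partition only gets coarser as the radius grows, and it is right-continuous in the radius;
  hence it changes at \<open>r\<close> iff it differs at \<open>r\<close> from what it is at every smaller radius.
\<close>

definition change_radii :: "nat \<Rightarrow> (nat \<Rightarrow> 'a::real_normed_vector) \<Rightarrow> real set" where
  "change_radii n x = {r. 0 < r \<and> (\<forall>s. 0 \<le> s \<and> s < r \<longrightarrow> clusters n x s \<noteq> clusters n x r)}"

text \<open>
  With \<open>\<rho>\<^sub>1 < \<dots> < \<rho>\<^sub>K\<close> the elements of \<^const>\<open>change_radii\<close> and \<open>\<rho>\<^sub>0 = 0\<close>, this is
  \<open>{\<rho>\<^sub>0, \<dots>, \<rho>\<^sub>K\<^sub>-\<^sub>1}\<close> when \<open>K \<ge> 1\<close>.
\<close>

definition candidate_radii :: "nat \<Rightarrow> (nat \<Rightarrow> 'a::real_normed_vector) \<Rightarrow> real set" where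
  "candidate_radii n x = insert 0 (change_radii n x) - {Max (change_radii n x)}"

definition selected_radius :: "nat \<Rightarrow> nat \<Rightarrow> (nat \<Rightarrow> 'a::real_normed_vector) \<Rightarrow> real" where
  "selected_radius n M x =
     (if change_radii n x = {} then 0
      else Max {\<rho>. is_arg_max (\<lambda>\<rho>. card (ranked_cluster n x \<rho> M))
                              (\<lambda>\<rho>. \<rho> \<in> candidate_radii n x) \<rho>})"

section \<open>Clustering risk\<close>

definition clustering_risk ::
    "'w measure \<Rightarrow> (nat \<Rightarrow> 'w \<Rightarrow> 'a::real_normed_vector) \<Rightarrow> nat \<Rightarrow> nat \<Rightarrow> (nat \<Rightarrow> 'a set) \<Rightarrow>
     ('w \<Rightarrow> real) \<Rightarrow> real" where
  "clustering_risk \<Omega> X n M S r =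
     measure \<Omega> {\<omega> \<in> space \<Omega>. \<forall>\<pi>. \<pi> permutes {1..M} \<longrightarrow>
       (\<exists>i\<in>{1..M}. \<not> {k \<in> {1..n}. X k \<omega> \<in> S i}
                       \<subseteq> ranked_cluster n (\<lambda>k. X k \<omega>) (r \<omega>) (\<pi> i))}"

end

theory Submission
  imports Defs
begin

text \<open>
  Fix a radius \<open>\<rho>\<close>. Three events can spoil the clustering: some ball of a net of \<open>S i\<close> of mesh
  \<open>\<rho> / 4\<close> contains no observation, so that the observations of \<open>S i\<close> may be disconnected; a chain
  of about \<open>\<delta> / \<rho>\<close> distinct outliers with steps at most \<open>\<rho>\<close> may join two supports; or the numbers
  \<open>N i\<close> of observations in \<open>S i\<close> violate \<open>2 * N i > N j + N 0\<close>. Off these events the supports are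
  separated at radius \<open>\<rho>\<close>, hence also at the selected radius, whatever its value. Their probabilities
  are at most of order \<open>\<rho> powr (- d) * exp (- c * n * \<rho> powr d)\<close>,
  \<open>\<rho> powr (- D) * (C * n * \<epsilon> * \<rho> powr D) powr (c / \<rho>)\<close> and \<open>exp (- c * n)\<close> (Hoeffding), and \<open>\<rho>\<close> is
  optimised in each regime.
\<close>

section \<open>Clusters and the selected radius\<close>

text \<open>The selected radius depends on the whole sample, so bounds at single deterministic radii
  would have to be made uniform in the radius. This is avoided because the inequality on the class
  sizes constrains every partition at once: with t the smallest class size, two clusters of size at
  least t that meet the same support and no other would need 2 t places among fewer than 2 t
  observations. Good behaviour at one deterministic radius \<rho> then settles the comparison with
  all smaller radii by counting.

  In the chain bound the n^m choices of indices multiply the m-th power of the probability that an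
  observation is an outlier in a given cell. The base is thus of order n \<epsilon> \<rho>^D, and it
  is small only if \<rho> is at most a constant times (n \<epsilon>)^(-1/D). This constraint, when
  it is stronger than the balance between net and chains, produces the regime of many outliers.

  The constants have to precede n and \<epsilon>. The class weights and the gap in the expected
  sizes are therefore bounded below uniformly over the admissible \<epsilon>, which is where the
  threshold on \<epsilon> enters.\<close>

lemma rank_bij_betw:
  assumes "finite A"
    and asym: "\<And>a b. a \<in> A \<Longrightarrow> b \<in> A \<Longrightarrow> R a b \<Longrightarrow> \<not> R b a"
    and trans: "\<And>a b c. a \<in> A \<Longrightarrow> b \<in> A \<Longrightarrow> c \<in> A \<Longrightarrow> R a b \<Longrightarrow> R b c \<Longrightarrow> R a c"
    and total: "\<And>a b. a \<in> A \<Longrightarrow> b \<in> A \<Longrightarrow> a \<noteq> b \<Longrightarrow> R a b \<or> R b a"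
  shows "bij_betw (\<lambda>a. card {b \<in> A. R b a}) A {..<card A}"
proof -
  let ?f = "\<lambda>a. card {b \<in> A. R b a}"
  \<comment> \<open>Everything before \<open>a\<close> is also before \<open>b\<close>, and
    \<open>a\<close> itself is before \<open>b\<close> but not before \<open>a\<close>.\<close>
  have less: "?f a < ?f b" if "a \<in> A" "b \<in> A" "R a b" for a b
  proof (rule psubset_card_mono)
    show "finite {c \<in> A. R c b}" using assms(1) by simp
    show "{c \<in> A. R c a} \<subset> {c \<in> A. R c b}"
      using that asym trans by blast
  qed
  have "inj_on ?f A"
  proof (rule inj_onI, rule ccontr)
    fix a b assume "a \<in> A" "b \<in> A" "?f a = ?f b" "a \<noteq> b"
    then show False using less[of a b] less[of b a] total[of a b] by auto
  qed
  moreover have "?f ` A \<subseteq> {..<card A}"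
  proof -
    have "?f a < card A" if "a \<in> A" for a
      by (rule psubset_card_mono[OF assms(1)]) (use that asym in blast)
    then show ?thesis by auto
  qed
  ultimately show ?thesis
    by (simp add: bij_betw_def card_image card_subset_eq)
qed

lemma neighbour_graph_mono: "r \<le> r' \<Longrightarrow> neighbour_graph n x r \<subseteq> neighbour_graph n x r'"
  by (auto simp: neighbour_graph_def)

lemma neighbour_graph_sym: "sym (neighbour_graph n x r)"
  by (auto simp: neighbour_graph_def sym_def norm_minus_commute)

lemma neighbour_graph_rtrancl_index:
  "(k, l) \<in> (neighbour_graph n x r)\<^sup>* \<Longrightarrow> k \<in> {1..n} \<Longrightarrow> l \<in> {1..n}"
  by (induction rule: rtrancl_induct) (auto simp: neighbour_graph_def)

lemma neighbour_graph_rtrancl_sym: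
  "(k, l) \<in> (neighbour_graph n x r)\<^sup>* \<Longrightarrow> (l, k) \<in> (neighbour_graph n x r)\<^sup>*"
  using neighbour_graph_sym sym_rtrancl by (metis symD)

lemma clustersE:
  assumes "C \<in> clusters n x r" "k \<in> C"
  shows "k \<in> {1..n}" "C = (neighbour_graph n x r)\<^sup>* `` {k}"
proof -
  obtain l where l: "l \<in> {1..n}" "C = (neighbour_graph n x r)\<^sup>* `` {l}"
    using assms(1) by (auto simp: clusters_def quotient_def)
  then have lk: "(l, k) \<in> (neighbour_graph n x r)\<^sup>*" using assms by auto
  show "k \<in> {1..n}" using neighbour_graph_rtrancl_index[OF lk l(1)] .
  show "C = (neighbour_graph n x r)\<^sup>* `` {k}"
    using l lk neighbour_graph_rtrancl_sym[OF lk] by (auto intro: rtrancl_trans)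
qed

lemma cluster_of_in_clusters:
  "k \<in> {1..n} \<Longrightarrow> (neighbour_graph n x r)\<^sup>* `` {k} \<in> clusters n x r"
  by (auto simp: clusters_def quotient_def)

lemma clusters_disjoint:
  "C \<in> clusters n x r \<Longrightarrow> C' \<in> clusters n x r \<Longrightarrow> k \<in> C \<Longrightarrow> k \<in> C' \<Longrightarrow> C = C'"
  using clustersE(2) by metis

lemma clusters_subset: "C \<in> clusters n x r \<Longrightarrow> C \<subseteq> {1..n}"
  using clustersE(1) by blast

lemma finite_cluster: "C \<in> clusters n x r \<Longrightarrow> finite C"
  using finite_subset[OF clusters_subset] by simp

lemma clusters_nonempty: "C \<in> clusters n x r \<Longrightarrow> C \<noteq> {}"
  by (auto simp: clusters_def quotient_def)

lemma finite_clusters: "finite (clusters n x r)"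
  by (rule finite_subset[of _ "Pow {1..n}"]) (use clusters_subset[of _ n x r] in \<open>blast, simp\<close>)

lemma clusters_coarsen:
  assumes "r \<le> r'" "C \<in> clusters n x r"
  obtains C' where "C' \<in> clusters n x r'" "C \<subseteq> C'"
proof -
  obtain k where k: "k \<in> C" using clusters_nonempty[OF assms(2)] by auto
  have "C \<subseteq> (neighbour_graph n x r')\<^sup>* `` {k}"
    using clustersE(2)[OF assms(2) k] rtrancl_mono[OF neighbour_graph_mono[OF assms(1)]] by blast
  then show ?thesis using that cluster_of_in_clusters clustersE(1)[OF assms(2) k] by blast
qed

text \<open>Distinct clusters are disjoint, so their least indices differ and no tie survives:
  \<open>larger_cluster\<close> is a strict total order, and the description in
  \<open>ranked_cluster\<close> is well defined.\<close>

lemma larger_cluster_rank_bij: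
  "bij_betw (\<lambda>C. card {C' \<in> clusters n x r. larger_cluster C' C}) (clusters n x r)
     {..<card (clusters n x r)}"
proof (rule rank_bij_betw[OF finite_clusters])
  fix C C' assume C: "C \<in> clusters n x r" "C' \<in> clusters n x r" "C \<noteq> C'"
  have "Min C \<in> C" "Min C' \<in> C'"
    using C finite_cluster clusters_nonempty by (metis Min_in)+
  then have "Min C \<noteq> Min C'" using clusters_disjoint C by metis
  then show "larger_cluster C C' \<or> larger_cluster C' C" by (auto simp: larger_cluster_def)
qed (auto simp: larger_cluster_def)

lemma ranked_cluster_eqI:
  assumes "C \<in> clusters n x r" "m = Suc (card {C' \<in> clusters n x r. larger_cluster C' C})"
  shows "ranked_cluster n x r m = C"
proof -
  let ?f = "\<lambda>C. card {C' \<in> clusters n x r. larger_cluster C' C}"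
  note b = larger_cluster_rank_bij[of n x r]
  have "?f C < card (clusters n x r)"
    using bij_betwE[OF b] assms(1) by auto
  moreover have "(THE D. D \<in> clusters n x r \<and> ?f D = m - 1) = C"
    by (rule the_equality) (use assms bij_betw_imp_inj_on[OF b] in \<open>auto simp: inj_on_def\<close>)
  ultimately show ?thesis using assms(2) by (auto simp: ranked_cluster_def)
qed

lemma ranked_clusterE:
  assumes "1 \<le> m" "m \<le> card (clusters n x r)"
  obtains C where "C \<in> clusters n x r" "card {C' \<in> clusters n x r. larger_cluster C' C} = m - 1"
    "ranked_cluster n x r m = C"
proof -
  have "m - 1 \<in> {..<card (clusters n x r)}" using assms by auto
  then obtain C where C: "C \<in> clusters n x r"
      "card {C' \<in> clusters n x r. larger_cluster C' C} = m - 1"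
    using larger_cluster_rank_bij[of n x r] unfolding bij_betw_def by (metis (no_types, lifting) imageE)
  then show ?thesis using that[OF C] ranked_cluster_eqI[OF C(1), of m] assms by simp
qed

text \<open>Pigeonhole: if the \<open>M\<close>-th cluster were smaller than \<open>t\<close>, all
  \<open>M\<close> members of \<open>F\<close> would precede it, but only \<open>M - 1\<close>
  clusters do.\<close>

lemma card_ranked_cluster_ge:
  assumes "F \<subseteq> clusters n x r" "card F = M" "1 \<le> M" "\<And>C. C \<in> F \<Longrightarrow> t \<le> card C"
  shows "t \<le> card (ranked_cluster n x r M)"
proof -
  have "M \<le> card (clusters n x r)"
    using assms card_mono finite_clusters by metis
  then obtain C where C: "C \<in> clusters n x r"
      "card {C' \<in> clusters n x r. larger_cluster C' C} = M - 1" "ranked_cluster n x r M = C"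
    using assms(3) by (elim ranked_clusterE)
  show ?thesis
  proof (rule ccontr)
    assume "\<not> t \<le> card (ranked_cluster n x r M)"
    then have "F \<subseteq> {C' \<in> clusters n x r. larger_cluster C' C}"
      using C assms by (fastforce simp: larger_cluster_def)
    then have "M \<le> M - 1"
      using C(2) assms(2) card_mono[of "{C' \<in> clusters n x r. larger_cluster C' C}" F]
      by (simp add: finite_clusters)
    then show False using assms(3) by simp
  qed
qed

text \<open>Converse of the previous lemma: the \<open>M\<close>-th cluster and its
  \<open>M - 1\<close> predecessors form \<open>F\<close>. The condition \<open>0 < t\<close>
  excludes the default value \<open>{}\<close>.\<close>

lemma card_ranked_cluster_geE:
  assumes "t \<le> card (ranked_cluster n x r M)" "0 < t" "1 \<le> M"
  obtains F where "F \<subseteq> clusters n x r" "card F = M" "\<And>C. C \<in> F \<Longrightarrow> t \<le> card C"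
proof -
  have "M \<le> card (clusters n x r)"
    using assms by (auto simp: ranked_cluster_def split: if_splits)
  then obtain C where C: "C \<in> clusters n x r"
      "card {C' \<in> clusters n x r. larger_cluster C' C} = M - 1" "ranked_cluster n x r M = C"
    using assms(3) by (elim ranked_clusterE)
  let ?L = "{C' \<in> clusters n x r. larger_cluster C' C}"
  have "C \<notin> ?L" by (auto simp: larger_cluster_def)
  then have "card (insert C ?L) = M"
    using C(2) assms(3) by (simp add: finite_clusters)
  moreover have "insert C ?L \<subseteq> clusters n x r" using C by blast
  moreover have "t \<le> card C'" if "C' \<in> insert C ?L" for C'
    using that C(3) assms(1) by (auto simp: larger_cluster_def)
  ultimately show ?thesis using that by blast
qed

section \<open>The radii at which the partition changes\<close>

text \<open>
  Only the pairwise distances matter: \<open>r\<close> may be rounded down to the nearest one.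
\<close>

lemma neighbour_graph_discretise:
  assumes "0 \<le> r" "V = insert 0 ((\<lambda>(k, l). norm (x k - x l)) ` ({1..n} \<times> {1..n}))"
  shows "Max {v \<in> V. v \<le> r} \<in> V" "Max {v \<in> V. v \<le> r} \<le> r"
    "neighbour_graph n x (Max {v \<in> V. v \<le> r}) = neighbour_graph n x r"
proof -
  have fin: "finite {v \<in> V. v \<le> r}" using assms by auto
  have "{v \<in> V. v \<le> r} \<noteq> {}" using assms by auto
  from Max_in[OF fin this] show le: "Max {v \<in> V. v \<le> r} \<in> V" "Max {v \<in> V. v \<le> r} \<le> r" by auto
  show "neighbour_graph n x (Max {v \<in> V. v \<le> r}) = neighbour_graph n x r"
  proof
    show "neighbour_graph n x r \<subseteq> neighbour_graph n x (Max {v \<in> V. v \<le> r})"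
    proof
      fix p assume "p \<in> neighbour_graph n x r"
      then obtain k l where p: "p = (k, l)" "k \<in> {1..n}" "l \<in> {1..n}" "norm (x k - x l) \<le> r"
        by (auto simp: neighbour_graph_def)
      then have "norm (x k - x l) \<in> {v \<in> V. v \<le> r}" using assms(2) by auto
      then have "norm (x k - x l) \<le> Max {v \<in> V. v \<le> r}" using Max_ge fin by blast
      then show "p \<in> neighbour_graph n x (Max {v \<in> V. v \<le> r})"
        using p by (auto simp: neighbour_graph_def)
    qed
  qed (rule neighbour_graph_mono[OF le(2)])
qed

text \<open>Every change radius is a pairwise distance: rounding it down to one leaves the partition
  as it is, so the rounding cannot decrease it.\<close>

lemma finite_change_radii: "finite (change_radii n x)"
proof -
  define V where "V = insert 0 ((\<lambda>(k, l). norm (x k - x l)) ` ({1..n} \<times> {1..n}))"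
  have "r \<in> V" if r: "r \<in> change_radii n x" for r
  proof -
    have "0 \<le> r" using r by (auto simp: change_radii_def)
    note d = neighbour_graph_discretise[OF this V_def]
    have "0 \<le> Max {v \<in> V. v \<le> r}" using d(1) by (auto simp: V_def)
    then have "\<not> Max {v \<in> V. v \<le> r} < r"
      using r d(3) by (auto simp: change_radii_def clusters_def)
    then show ?thesis using d by simp
  qed
  moreover have "finite V" by (simp add: V_def)
  ultimately show ?thesis by (meson finite_subset subsetI)
qed

text \<open>The witness is the least distance (or 0) with the same partition as \<open>r\<close>. If
  it were no change radius, a smaller radius would have this partition too, and rounding that one
  down would contradict minimality.\<close>

lemma clusters_at_change_radius:
  assumes "0 \<le> r"
  obtains v where "v \<in> insert 0 (change_radii n x)" "v \<le> r" "clusters n x v = clusters n x r"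
proof -
  define V where "V = insert 0 ((\<lambda>(k, l). norm (x k - x l)) ` ({1..n} \<times> {1..n}))"
  define W where "W = {v \<in> V. clusters n x v = clusters n x r}"
  note d = neighbour_graph_discretise[OF assms V_def]
  have fin: "finite W" by (simp add: W_def V_def)
  have mem: "Max {v \<in> V. v \<le> r} \<in> W" using d by (simp add: W_def clusters_def)
  define v where "v = Min W"
  have v: "v \<in> W" using fin mem Min_in v_def by blast
  have vr: "v \<le> r" using Min_le[OF fin mem] d(2) by (simp add: v_def)
  have "v \<in> insert 0 (change_radii n x)"
  proof (rule ccontr)
    assume *: "v \<notin> insert 0 (change_radii n x)"
    moreover have "0 \<le> v" using v by (auto simp: W_def V_def)
    ultimately obtain u where u: "0 \<le> u" "u < v" "clusters n x u = clusters n x v"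
      by (fastforce simp: change_radii_def)
    note e = neighbour_graph_discretise[OF u(1) V_def]
    have "Max {v \<in> V. v \<le> u} \<in> W" using e u v by (simp add: W_def clusters_def)
    then have "v \<le> Max {v \<in> V. v \<le> u}" using fin by (simp add: v_def)
    then show False using e(2) u(2) by simp
  qed
  then show ?thesis using that vr v by (simp add: W_def)
qed

lemma clusters_large_radius:
  assumes "\<And>k l. k \<in> {1..n} \<Longrightarrow> l \<in> {1..n} \<Longrightarrow> norm (x k - x l) \<le> r" "C \<in> clusters n x r"
  shows "C = {1..n}"
proof -
  obtain k where k: "k \<in> C" using clusters_nonempty[OF assms(2)] by auto
  have "{1..n} \<subseteq> (neighbour_graph n x r)\<^sup>* `` {k}"
    using assms(1) clustersE(1)[OF assms(2) k] by (auto simp: neighbour_graph_def)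
  then show ?thesis using clustersE(2)[OF assms(2) k] clusters_subset[OF assms(2)] by blast
qed

lemma trivial_clusters_at_change_radius:
  obtains v where "v \<in> insert 0 (change_radii n x)" "clusters n x v \<subseteq> {{1..n}}"
proof -
  \<comment> \<open>The sum of all distances bounds each of them, so the graph is complete at this
    radius.\<close>
  define r where "r = (\<Sum>k=1..n. \<Sum>l=1..n. norm (x k - x l))"
  have "norm (x k - x l) \<le> r" if "k \<in> {1..n}" "l \<in> {1..n}" for k l
  proof -
    have "norm (x k - x l) \<le> (\<Sum>l=1..n. norm (x k - x l))"
      using that by (intro member_le_sum) auto
    also have "\<dots> \<le> r"
      unfolding r_def using that
      by (intro member_le_sum[where f = "\<lambda>k. \<Sum>l=1..n. norm (x k - x l)"]) (auto intro: sum_nonneg)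
    finally show ?thesis .
  qed
  then have "clusters n x r \<subseteq> {{1..n}}" using clusters_large_radius by blast
  moreover have "0 \<le> r" unfolding r_def by (intro sum_nonneg) auto
  ultimately show ?thesis using that clusters_at_change_radius by metis
qed

text \<open>This identifies the maximum with the last radius of the list: the partition is trivial
  at some listed radius and only coarsens from there on. An inclusion instead of an equality also
  covers \<open>n = 0\<close>.\<close>

lemma clusters_at_Max_change_radius:
  assumes "change_radii n x \<noteq> {}" "v = Max (change_radii n x)"
  shows "clusters n x v \<subseteq> {{1..n}}"
proof -
  obtain u where u: "u \<in> insert 0 (change_radii n x)" "clusters n x u \<subseteq> {{1..n}}"
    by (rule trivial_clusters_at_change_radius)
  have "v \<in> change_radii n x" using assms finite_change_radii Max_in by blast
  then have "u \<le> v" using u(1) assms finite_change_radii[of n x] by (auto simp: change_radii_def)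
  show ?thesis
  proof
    fix C assume C: "C \<in> clusters n x v"
    obtain k where k: "k \<in> C" using clusters_nonempty[OF C] by auto
    then have kn: "k \<in> {1..n}" using clustersE C by blast
    then have "(neighbour_graph n x u)\<^sup>* `` {k} = {1..n}"
      using u(2) cluster_of_in_clusters by blast
    moreover have "(neighbour_graph n x u)\<^sup>* `` {k} \<subseteq> C"
      using clustersE(2)[OF C k] rtrancl_mono[OF neighbour_graph_mono[OF \<open>u \<le> v\<close>]] by blast
    ultimately show "C \<in> {{1..n}}" using clusters_subset[OF C] by auto
  qed
qed

text \<open>A listed radius with a nontrivial partition is not the last one, hence competes in the
  argmax. The second conclusion is where the choice of the largest maximiser enters.\<close>

lemma selected_radius_maximises:
  assumes v: "v \<in> insert 0 (change_radii n x)" "\<not> clusters n x v \<subseteq> {{1..n}}"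
  shows "card (ranked_cluster n x v M) \<le> card (ranked_cluster n x (selected_radius n M x) M)"
    and "card (ranked_cluster n x (selected_radius n M x) M) \<le> card (ranked_cluster n x v M)
      \<Longrightarrow> v \<le> selected_radius n M x"
proof -
  have ne: "change_radii n x \<noteq> {}"
    using v trivial_clusters_at_change_radius[of n x] by (metis singletonD insertE)
  then have vc: "v \<in> candidate_radii n x"
    using v clusters_at_Max_change_radius[OF ne] by (auto simp: candidate_radii_def)
  let ?f = "\<lambda>\<rho>. card (ranked_cluster n x \<rho> M)"
  let ?P = "\<lambda>\<rho>. \<rho> \<in> candidate_radii n x"
  define A where "A = {\<rho>. is_arg_max ?f ?P \<rho>}"
  have finc: "finite (candidate_radii n x)" by (simp add: candidate_radii_def finite_change_radii)
  have A: "A = {\<rho> \<in> candidate_radii n x. \<forall>\<sigma>\<in>candidate_radii n x. ?f \<sigma> \<le> ?f \<rho>}"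
    by (auto simp: A_def is_arg_max_def not_less)
  have finA: "finite A" using finc A by simp
  have "?f ` candidate_radii n x \<noteq> {}" using vc by auto
  then obtain w where w: "w \<in> candidate_radii n x" "?f w = Max (?f ` candidate_radii n x)"
    using Max_in finc by (metis (no_types, lifting) finite_imageI imageE)
  have "w \<in> A" unfolding A using w finc by auto
  then have "Max A \<in> A" using finA Max_in by blast
  moreover have sel: "selected_radius n M x = Max A"
    using ne by (simp add: selected_radius_def A_def)
  ultimately have r: "selected_radius n M x \<in> A" by simp
  then show "?f v \<le> ?f (selected_radius n M x)" using r vc unfolding A by auto
  assume "?f (selected_radius n M x) \<le> ?f v"
  then have "v \<in> A" using r vc unfolding A by (auto intro: order_trans)
  then show "v \<le> selected_radius n M x" using finA sel by simp
qed

text \<open>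
  \<open>I 1, \<dots>, I M\<close> are the observations of the supports and \<open>I 0\<close> the outliers. Below \<open>\<rho>\<close> the size
  condition forces exactly one big cluster per support, so the \<open>M\<close>-th largest cluster cannot be
  larger than at \<open>\<rho>\<close>. As the selected radius is the largest maximiser, it lies above the change
  radius of \<open>\<rho>\<close>; there every support is connected, and the supports cannot have merged because a
  cluster of outliers alone is too small to be the \<open>M\<close>-th largest.
\<close>

lemma selected_radius_separates:
  fixes I :: "nat \<Rightarrow> nat set"
  assumes M: "2 \<le> M" and "0 \<le> \<rho>"
    and cover: "{1..n} = (\<Union>i\<in>{0..M}. I i)"
    and connected_class: "\<And>i k l. i \<in> {1..M} \<Longrightarrow> k \<in> I i \<Longrightarrow> l \<in> I i \<Longrightarrow>
          (k, l) \<in> (neighbour_graph n x \<rho>)\<^sup>*"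
    and separated: "\<And>i j k l. i \<in> {1..M} \<Longrightarrow> j \<in> {1..M} \<Longrightarrow> k \<in> I i \<Longrightarrow> l \<in> I j \<Longrightarrow>
          (k, l) \<in> (neighbour_graph n x \<rho>)\<^sup>* \<Longrightarrow> i = j"
    and sizes: "\<And>i j. i \<in> {1..M} \<Longrightarrow> j \<in> {1..M} \<Longrightarrow> card (I j) + card (I 0) < 2 * card (I i)"
  obtains \<pi> where "\<pi> permutes {1..M}"
    "\<And>i. i \<in> {1..M} \<Longrightarrow> I i \<subseteq> ranked_cluster n x (selected_radius n M x) (\<pi> i)"
proof -
  obtain v where v: "v \<in> insert 0 (change_radii n x)" "v \<le> \<rho>" "clusters n x v = clusters n x \<rho>"
    using clusters_at_change_radius[OF \<open>0 \<le> \<rho>\<close>] .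
  define G where "G r k = (neighbour_graph n x r)\<^sup>* `` {k}" for r k
  define e where "e i = (SOME k. k \<in> I i)" for i
  have sub: "I i \<subseteq> {1..n}" if "i \<in> {0..M}" for i using cover that by blast
  have fin: "finite (I i)" if "i \<in> {0..M}" for i using sub[OF that] finite_subset by blast
  have e: "e i \<in> I i" "e i \<in> {1..n}" if "i \<in> {1..M}" for i
  proof -
    have "0 < card (I i)" using sizes[OF that that] by simp
    then have "I i \<noteq> {}" by auto
    then show "e i \<in> I i" unfolding e_def by (simp add: some_in_eq)
    then show "e i \<in> {1..n}" using sub[of i] that by auto
  qed
  have GC: "G r (e i) \<in> clusters n x r" if "i \<in> {1..M}" for r i
    unfolding G_def using cluster_of_in_clusters e(2)[OF that] by blast
  have Gv: "G v k = G \<rho> k" if "k \<in> {1..n}" for k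
    using v(3) clustersE(2) cluster_of_in_clusters that unfolding G_def
    by (metis ImageI rtrancl.rtrancl_refl singletonI)
  have IG: "I i \<subseteq> G r (e i)" if "v \<le> r" "i \<in> {1..M}" for r i
  proof -
    have "I i \<subseteq> G \<rho> (e i)" using connected_class e that by (auto simp: G_def)
    also have "\<dots> = G v (e i)" using Gv e that by simp
    also have "\<dots> \<subseteq> G r (e i)"
      unfolding G_def using rtrancl_mono[OF neighbour_graph_mono[OF that(1)]] by blast
    finally show ?thesis .
  qed
  have sep: "i = j" if "C \<in> clusters n x r" "r \<le> v" "i \<in> {1..M}" "j \<in> {1..M}"
      "k \<in> C" "l \<in> C" "k \<in> I i" "l \<in> I j" for C r i j k l
  proof -
    have "(k, l) \<in> (neighbour_graph n x r)\<^sup>*" using clustersE(2)[of C n x r k] that by auto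
    then have "(k, l) \<in> (neighbour_graph n x \<rho>)\<^sup>*"
      using rtrancl_mono[OF neighbour_graph_mono, of r \<rho>] that(2) v(2) by auto
    then show ?thesis using separated that by blast
  qed
  \<comment> \<open>The smallest class size is the threshold for a big cluster. Clusters of outliers
    alone stay below it, by the case \<open>j = i\<close> of \<open>sizes\<close>, and every class
    together with the outliers has fewer than \<open>2 * t\<close> elements.\<close>
  define t where "t = Min ((\<lambda>i. card (I i)) ` {1..M})"
  have t_le: "t \<le> card (I i)" if "i \<in> {1..M}" for i
    unfolding t_def using that by (intro Min_le) auto
  have "t \<in> (\<lambda>i. card (I i)) ` {1..M}" unfolding t_def using M by (intro Min_in) auto
  then obtain i0 where i0: "i0 \<in> {1..M}" "t = card (I i0)" by auto
  have t_I0: "card (I 0) < t" using sizes[of i0 i0] i0 by simp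
  have t_2: "card (I i) + card (I 0) < 2 * t" if "i \<in> {1..M}" for i
    using sizes[of i0 i] i0 that by simp
  have meets: "\<exists>i\<in>{1..M}. C \<inter> I i \<noteq> {}" if "C \<in> clusters n x r" "t \<le> card C" for C r
  proof (rule ccontr)
    assume no: "\<not> ?thesis"
    have "C \<subseteq> I 0"
    proof
      fix k assume k: "k \<in> C"
      then have "k \<in> (\<Union>i\<in>{0..M}. I i)" using clusters_subset[OF that(1)] cover by blast
      then obtain i where i: "i \<in> {0..M}" "k \<in> I i" by blast
      then show "k \<in> I 0" using no k by (cases "i = 0") auto
    qed
    then have "card C \<le> card (I 0)" using fin[of 0] by (simp add: card_mono)
    then show False using that(2) t_I0 by simp
  qed
  have G_distinct: "inj_on (\<lambda>i. G v (e i)) {1..M}"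
  proof (rule inj_onI)
    fix i j assume ij: "i \<in> {1..M}" "j \<in> {1..M}" "G v (e i) = G v (e j)"
    show "i = j"
      using sep[OF GC[OF ij(1), of v] order_refl ij(1,2), of "e i" "e j"] ij e(1)
        IG[of v i] IG[of v j] by (metis order_refl subsetD)
  qed
  have f_v: "u \<le> card (ranked_cluster n x v M)"
    if "\<And>i. i \<in> {1..M} \<Longrightarrow> u \<le> card (G v (e i))" for u
    using that GC M card_image[OF G_distinct]
    by (intro card_ranked_cluster_ge[of "(\<lambda>i. G v (e i)) ` {1..M}"]) auto
  have t_G: "t \<le> card (G r (e i))" if "v \<le> r" "i \<in> {1..M}" for r i
    using t_le[OF that(2)] card_mono[OF finite_cluster[OF GC[OF that(2)]] IG[OF that]] by simp
  have nontrivial: "\<not> clusters n x v \<subseteq> {{1..n}}"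
  proof
    assume "clusters n x v \<subseteq> {{1..n}}"
    then have "G v (e 1) = G v (e 2)" using GC[of 1 v] GC[of 2 v] M by auto
    then show False using inj_onD[OF G_distinct, of 1 2] M by auto
  qed
  define R where "R = selected_radius n M x"
  note sel = selected_radius_maximises[OF v(1) nontrivial, of M, folded R_def]
  have f_R: "t \<le> card (ranked_cluster n x R M)"
    using f_v[OF t_G[OF order_refl]] sel(1) by simp
  \<comment> \<open>If \<open>R < v\<close>, the \<open>M\<close> clusters of size at least
    \<open>u\<close> at \<open>R\<close> belong to distinct supports and are contained in the
    clusters \<open>G v (e i)\<close>. The \<open>M\<close>-th size at \<open>v\<close> is then at
    least \<open>u\<close>, and the tie rule puts \<open>R\<close> at or above
    \<open>v\<close>.\<close>
  have "v \<le> R"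
  proof (rule ccontr)
    assume "\<not> v \<le> R"
    then have Rv: "R \<le> v" by simp
    define u where "u = card (ranked_cluster n x R M)"
    have u: "t \<le> u" "0 < u" using f_R t_I0 by (auto simp: u_def)
    obtain F where F: "F \<subseteq> clusters n x R" "card F = M" "\<And>C. C \<in> F \<Longrightarrow> u \<le> card C"
      using card_ranked_cluster_geE[of u n x R M] u M by (auto simp: u_def)
    have "\<forall>C\<in>F. \<exists>i\<in>{1..M}. C \<inter> I i \<noteq> {}"
      using meets F u by (meson order_trans subsetD)
    then obtain h where h: "\<And>C. C \<in> F \<Longrightarrow> h C \<in> {1..M}" "\<And>C. C \<in> F \<Longrightarrow> C \<inter> I (h C) \<noteq> {}"
      by metis
    have "inj_on h F"
    proof (rule inj_onI, rule ccontr)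
      fix C C' assume C: "C \<in> F" "C' \<in> F" "h C = h C'" "C \<noteq> C'"
      \<comment> \<open>Up to \<open>v\<close> no cluster meets two supports, so \<open>C\<close>
        and \<open>C'\<close> both lie in the class \<open>I (h C)\<close> together with the
        outliers, which is too small for two disjoint clusters of size at least
        \<open>t\<close>.\<close>
      have part: "K \<subseteq> I (h K) \<union> I 0" if K: "K \<in> F" for K
      proof
        fix k assume k: "k \<in> K"
        then have "k \<in> (\<Union>i\<in>{0..M}. I i)" using clusters_subset F(1) K cover by blast
        then obtain i where i: "i \<in> {0..M}" "k \<in> I i" by blast
        obtain l where l: "l \<in> K" "l \<in> I (h K)" using h(2)[OF K] by auto
        show "k \<in> I (h K) \<union> I 0"
        proof (cases "i = 0")
          case False
          then show ?thesis using sep[of K R i "h K" k l] i l k K F(1) Rv h(1)[OF K] by auto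
        qed (use i in auto)
      qed
      have hC: "h C \<in> {1..M}" using h(1) C by blast
      have dis: "C \<inter> C' = {}" using clusters_disjoint C F(1) by blast
      have finC: "finite C" "finite C'" using finite_cluster C F(1) by blast+
      have "2 * t \<le> card C + card C'" using F(3) C u(1) by (metis add_mono mult_2 order_trans)
      also have "\<dots> = card (C \<union> C')" using card_Un_disjoint[OF finC dis] by simp
      also have "\<dots> \<le> card (I (h C) \<union> I 0)"
        using part[OF C(1)] part[OF C(2)] C(3) fin[of "h C"] fin[of 0] hC by (intro card_mono) simp_all
      also have "\<dots> \<le> card (I (h C)) + card (I 0)" by (rule card_Un_le)
      also have "\<dots> < 2 * t" using t_2 hC by blast
      finally show False by simp
    qed
    then have hF: "h ` F = {1..M}"
      using h(1) F(2) by (intro card_subset_eq) (auto simp: card_image)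
    have "u \<le> card (G v (e i))" if i: "i \<in> {1..M}" for i
    proof -
      obtain C where C: "C \<in> F" "h C = i" using hF i by (metis imageE)
      then have CR: "C \<in> clusters n x R" using F by auto
      obtain k where k: "k \<in> C" "k \<in> I i" using h(2) C by blast
      obtain C' where C': "C' \<in> clusters n x v" "C \<subseteq> C'"
        by (rule clusters_coarsen[OF Rv CR])
      have "C' = G v (e i)"
        using clusters_disjoint[OF C'(1) GC[OF i, of v], of k] k C' IG[OF order_refl i] by auto
      then show ?thesis
        using F(3)[OF C(1)] card_mono[OF finite_cluster[OF C'(1)] C'(2)] by simp
    qed
    then have "u \<le> card (ranked_cluster n x v M)" by (rule f_v)
    then show False using sel(2) \<open>\<not> v \<le> R\<close> by (simp add: u_def)
  qed
  \<comment> \<open>At \<open>R\<close> itself separation is not known. Each of the \<open>M\<close>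
    clusters of size at least \<open>t\<close> meets a support, hence is one of the sets
    \<open>G R (e i)\<close>; as these are at most \<open>M\<close>, they are pairwise
    distinct.\<close>
  obtain F where F: "F \<subseteq> clusters n x R" "card F = M" "\<And>C. C \<in> F \<Longrightarrow> t \<le> card C"
    using card_ranked_cluster_geE[OF f_R] M t_I0 by auto
  define B where "B = (\<lambda>i. G R (e i)) ` {1..M}"
  have big: "C \<in> B" if C: "C \<in> clusters n x R" "t \<le> card C" for C
  proof -
    obtain i k where i: "i \<in> {1..M}" "k \<in> C" "k \<in> I i" using meets[OF C] by blast
    then have "k \<in> G R (e i)" using IG[OF \<open>v \<le> R\<close> i(1)] by blast
    then have "C = G R (e i)"
      using clusters_disjoint[OF C(1) GC[OF i(1), of R] i(2)] by blast
    then show ?thesis using i(1) by (auto simp: B_def)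
  qed
  have "F \<subseteq> B" using F big by auto
  then have "M \<le> card B" using F(2) card_mono[of B F] by (simp add: B_def)
  then have cardB: "card B = M" using card_image_le[of "{1..M}" "\<lambda>i. G R (e i)"] by (simp add: B_def)
  then have injB: "inj_on (\<lambda>i. G R (e i)) {1..M}" by (intro eq_card_imp_inj_on) (auto simp: B_def)
  define rk where "rk C = Suc (card {C' \<in> clusters n x R. larger_cluster C' C})" for C
  have rk_inj: "inj_on rk (clusters n x R)"
    using bij_betw_imp_inj_on[OF larger_cluster_rank_bij[of n x R]] by (auto simp: rk_def inj_on_def)
  \<comment> \<open>A support is sent to the rank of its cluster. The rank is at most
    \<open>M\<close> because all larger clusters are big and so lie in \<open>B\<close>.\<close>
  define \<pi> where "\<pi> i = (if i \<in> {1..M} then rk (G R (e i)) else i)" for i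
  have rk_le: "rk (G R (e i)) \<in> {1..M}" if i: "i \<in> {1..M}" for i
  proof -
    have "{C' \<in> clusters n x R. larger_cluster C' (G R (e i))} \<subset> B"
    proof (rule psubsetI)
      show "{C' \<in> clusters n x R. larger_cluster C' (G R (e i))} \<subseteq> B"
        using big t_G[OF \<open>v \<le> R\<close> i] by (auto simp: larger_cluster_def)
      have "G R (e i) \<in> B" using i by (auto simp: B_def)
      then show "{C' \<in> clusters n x R. larger_cluster C' (G R (e i))} \<noteq> B"
        by (auto simp: larger_cluster_def)
    qed
    then have "card {C' \<in> clusters n x R. larger_cluster C' (G R (e i))} < card B"
      by (intro psubset_card_mono) (auto simp: B_def)
    then show ?thesis using cardB by (simp add: rk_def)
  qed
  have "inj_on \<pi> {1..M}"
  proof (rule inj_onI)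
    fix i j assume ij: "i \<in> {1..M}" "j \<in> {1..M}" "\<pi> i = \<pi> j"
    then have "rk (G R (e i)) = rk (G R (e j))" by (simp add: \<pi>_def)
    then have "G R (e i) = G R (e j)"
      using inj_onD[OF rk_inj] GC[OF ij(1)] GC[OF ij(2)] by blast
    then show "i = j" using inj_onD[OF injB] ij by blast
  qed
  moreover have "\<pi> ` {1..M} \<subseteq> {1..M}" using rk_le by (auto simp: \<pi>_def)
  ultimately have "bij_betw \<pi> {1..M} {1..M}"
    by (simp add: bij_betw_def endo_inj_surj)
  then have "\<pi> permutes {1..M}" by (rule bij_imp_permutes) (auto simp: \<pi>_def)
  moreover have "I i \<subseteq> ranked_cluster n x R (\<pi> i)" if "i \<in> {1..M}" for i
    using ranked_cluster_eqI[OF GC[OF that, of R]] IG[OF \<open>v \<le> R\<close> that] that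
    by (simp add: \<pi>_def rk_def)
  ultimately show ?thesis using that by (simp add: R_def)
qed

section \<open>Paths in the neighbour graph\<close>

text \<open>Minimality ranges over all pairs related by \<open>Q\<close>, not only the given
  endpoints, so a prefix or suffix with related ends would be a shorter competitor. A repeated
  vertex would allow the loop to be cut out.\<close>

lemma relpow_shortest_path:
  assumes "\<And>u a b. (a, b) \<in> R ^^ u \<Longrightarrow> Q a b \<Longrightarrow> t \<le> u"
    and "(f 0, f t) \<in> R ^^ t" "Q (f 0) (f t)" "\<And>i. i < t \<Longrightarrow> (f i, f (Suc i)) \<in> R"
  shows "inj_on f {..t}"
    and "\<And>i. 0 < i \<Longrightarrow> i < t \<Longrightarrow> \<not> Q (f 0) (f i) \<and> \<not> Q (f i) (f t)"
proof -
  have path: "(f i, f (i + u)) \<in> R ^^ u" if "i + u \<le> t" for i u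
    using that
  proof (induction u)
    case (Suc u)
    then show ?case using assms(4)[of "i + u"] by (auto intro: relpow_Suc_I)
  qed simp
  show "\<not> Q (f 0) (f i) \<and> \<not> Q (f i) (f t)" if "0 < i" "i < t" for i
    using assms(1)[of "f 0" "f i" i] assms(1)[of "f i" "f t" "t - i"] path[of 0 i] path[of i "t - i"]
      that by auto
  have "f i \<noteq> f j" if "i < j" "j \<le> t" for i j
  proof
    assume eq: "f i = f j"
    have "(f 0, f t) \<in> R ^^ i O R ^^ (t - j)"
      using path[of 0 i] path[of j "t - j"] that eq by auto
    then have "t \<le> i + (t - j)" using assms(1,3) by (metis relpow_add)
    then show False using that by simp
  qed
  then show "inj_on f {..t}" by (metis atMost_iff inj_onI linorder_neqE_nat)
qed

text \<open>
  A shortest path between two different supports visits no support in between and no vertex twice.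
\<close>

lemma outlier_chain:
  fixes x :: "nat \<Rightarrow> 'a::real_normed_vector" and M :: nat
  assumes cover: "{1..n} \<subseteq> (\<Union>i\<in>{0..M}. I i)"
    and far: "\<And>i j k l. i \<in> {1..M} \<Longrightarrow> j \<in> {1..M} \<Longrightarrow> i \<noteq> j \<Longrightarrow> k \<in> I i \<Longrightarrow> l \<in> I j \<Longrightarrow>
          \<delta> \<le> norm (x k - x l)"
    and linked: "i \<in> {1..M}" "j \<in> {1..M}" "i \<noteq> j" "k \<in> I i" "l \<in> I j"
      "(k, l) \<in> (neighbour_graph n x \<rho>)\<^sup>*"
    and m: "real m * \<rho> < \<delta>" "0 < \<rho>"
  obtains f where "inj_on f {..<m}" "\<And>j. j < m \<Longrightarrow> f j \<in> I 0 \<inter> {1..n}"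
    "\<And>j. Suc j < m \<Longrightarrow> norm (x (f j) - x (f (Suc j))) \<le> \<rho>"
proof -
  let ?R = "neighbour_graph n x \<rho>"
  define Q where "Q a b \<longleftrightarrow> (\<exists>i\<in>{1..M}. \<exists>j\<in>{1..M}. i \<noteq> j \<and> a \<in> I i \<and> b \<in> I j)" for a b
  define t where "t = (LEAST u. \<exists>a b. (a, b) \<in> ?R ^^ u \<and> Q a b)"
  have ex: "\<exists>u a b. (a, b) \<in> ?R ^^ u \<and> Q a b"
    using linked rtrancl_imp_relpow unfolding Q_def by meson
  obtain a b where ab: "(a, b) \<in> ?R ^^ t" "Q a b"
    using LeastI_ex[OF ex] unfolding t_def by blast
  have least: "t \<le> u" if "(a, b) \<in> ?R ^^ u" "Q a b" for u a b
    unfolding t_def by (rule Least_le) (use that in blast)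
  obtain f where f: "f 0 = a" "f t = b" "\<And>i. i < t \<Longrightarrow> (f i, f (Suc i)) \<in> ?R"
    using ab(1) unfolding relpow_fun_conv by blast
  note sp = relpow_shortest_path[of ?R Q t f, OF least _ _ f(3)]
  have inj: "inj_on f {..t}" using sp(1) ab f by simp
  have interior: "\<not> Q a (f i) \<and> \<not> Q (f i) b" if "0 < i" "i < t" for i
    using sp(2)[where i = i] that ab f by simp
  have step: "norm (x (f i) - x (f (Suc i))) \<le> \<rho>" if "i < t" for i
    using f(3)[OF that] by (auto simp: neighbour_graph_def)
  have "norm (x (f 0) - x (f u)) \<le> real u * \<rho>" if "u \<le> t" for u
    using that
  proof (induction u)
    case (Suc u)
    have "norm (x (f 0) - x (f (Suc u)))
        \<le> norm (x (f 0) - x (f u)) + norm (x (f u) - x (f (Suc u)))"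
      using norm_triangle_ineq[of "x (f 0) - x (f u)" "x (f u) - x (f (Suc u))"] by simp
    also have "\<dots> \<le> real u * \<rho> + \<rho>" using Suc step[of u] by (intro add_mono) auto
    finally show ?case by (simp add: algebra_simps)
  qed simp
  from this[of t] have "norm (x a - x b) \<le> real t * \<rho>" using f by simp
  moreover have "\<delta> \<le> norm (x a - x b)" using ab(2) far unfolding Q_def by blast
  ultimately have "real m * \<rho> < real t * \<rho>" using m by linarith
  \<comment> \<open>The endpoints are farther apart than \<open>m\<close> steps can reach, so at
    least \<open>m\<close> vertices are interior.\<close>
  then have mt: "m < t" using m(2) by simp
  have I0: "f i \<in> I 0 \<inter> {1..n}" if i: "0 < i" "i < t" for i
  proof -
    have fn: "f i \<in> {1..n}" using f(3)[OF i(2)] by (auto simp: neighbour_graph_def)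
    then obtain h where h: "h \<in> {0..M}" "f i \<in> I h" using cover by blast
    obtain p q where pq: "p \<in> {1..M}" "q \<in> {1..M}" "p \<noteq> q" "a \<in> I p" "b \<in> I q"
      using ab(2) unfolding Q_def by blast
    \<comment> \<open>A support \<open>h\<close> of an interior vertex differs from \<open>p\<close>
      or, being equal to \<open>p\<close>, differs from \<open>q\<close>; in both cases the vertex
      is related by \<open>Q\<close> to an endpoint.\<close>
    have "h = 0"
    proof (rule ccontr)
      assume "h \<noteq> 0"
      then have h1: "h \<in> {1..M}" using h by simp
      have "h \<noteq> p \<Longrightarrow> Q a (f i)"
        unfolding Q_def by (intro bexI[of _ p] bexI[of _ h]) (use pq h h1 in auto)
      moreover have "h = p \<Longrightarrow> Q (f i) b"
        unfolding Q_def by (intro bexI[of _ p] bexI[of _ q]) (use pq h in auto)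
      ultimately show False using interior[OF i] by blast
    qed
    then show ?thesis using h fn by simp
  qed
  \<comment> \<open>The shift skips \<open>f 0\<close>, which lies in a support.\<close>
  show ?thesis
  proof (rule that[of "\<lambda>j. f (Suc j)"])
    show "inj_on (\<lambda>j. f (Suc j)) {..<m}"
      using inj mt by (fastforce simp: inj_on_def)
  qed (use I0 step mt in auto)
qed

text \<open>The balls reached from \<open>k\<close> and the other balls form two open sets that
  cannot meet: overlapping balls of radius \<open>q\<close> hold observations at distance at most
  \<open>4 * q\<close>, which the graph joins. Connectedness of \<open>S\<close> leaves only reached
  balls. This is the origin of the factor 4 between the mesh and the radius.\<close>

lemma neighbour_graph_connects_net:
  fixes x :: "nat \<Rightarrow> 'a::real_normed_vector"
  assumes "connected S" "finite C" "S \<subseteq> (\<Union>c\<in>C. ball c q)"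
    and hit: "\<And>c. c \<in> C \<Longrightarrow> \<exists>k\<in>{1..n}. x k \<in> ball c q"
    and k: "k \<in> {1..n}" "x k \<in> S" and l: "l \<in> {1..n}" "x l \<in> S"
  shows "(k, l) \<in> (neighbour_graph n x (4 * q))\<^sup>*"
proof -
  let ?R = "neighbour_graph n x (4 * q)"
  let ?K = "?R\<^sup>* `` {k}"
  have q: "0 < q"
  proof -
    obtain c where "dist c (x k) < q" using assms(3) k(2) by auto
    then show ?thesis using zero_le_dist[of c "x k"] by linarith
  qed
  define C1 where "C1 = {c \<in> C. \<exists>h\<in>?K \<inter> {1..n}. x h \<in> ball c q}"
  define U where "U = (\<Union>c\<in>C1. ball c q)"
  define V where "V = (\<Union>c\<in>C - C1. ball c q)"
  have close: "(g, h) \<in> ?R" if "g \<in> {1..n}" "h \<in> {1..n}" "dist (x g) (x h) \<le> 4 * q" for g h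
    using that by (auto simp: neighbour_graph_def dist_norm)
  obtain ck where ck: "ck \<in> C" "x k \<in> ball ck q" using assms(3) k by auto
  then have "ck \<in> C1" using k by (auto simp: C1_def)
  then have kU: "x k \<in> U" using ck by (auto simp: U_def)
  have disj: "U \<inter> V \<inter> S = {}"
  proof (rule ccontr)
    assume "U \<inter> V \<inter> S \<noteq> {}"
    then obtain y where "y \<in> U" "y \<in> V" by blast
    then obtain c c' where y: "c \<in> C1" "c' \<in> C - C1" "y \<in> ball c q" "y \<in> ball c' q"
      unfolding U_def V_def by blast
    obtain g where g: "g \<in> ?K" "g \<in> {1..n}" "x g \<in> ball c q" using y by (auto simp: C1_def)
    obtain h where h: "h \<in> {1..n}" "x h \<in> ball c' q" using hit y by blast
    have "dist (x g) (x h) \<le> dist c (x g) + dist c y + (dist c' y + dist c' (x h))"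
      by (metis dist_commute dist_triangle_le dist_triangle add_mono)
    also have "\<dots> \<le> 4 * q" using y g h by auto
    finally have "(g, h) \<in> ?R" using close g h by blast
    then have "h \<in> ?K" using g by auto
    then have "c' \<in> C1" using h y by (auto simp: C1_def)
    then show False using y by simp
  qed
  have "S \<subseteq> U \<union> V" using assms(3) by (auto simp: U_def V_def)
  moreover have "open U" "open V" by (auto simp: U_def V_def)
  ultimately have "U \<inter> S = {} \<or> V \<inter> S = {}"
    using assms(1) disj unfolding connected_def by blast
  then have "S \<subseteq> U" using kU k \<open>S \<subseteq> U \<union> V\<close> by blast
  then obtain c where c: "c \<in> C1" "x l \<in> ball c q" using l unfolding U_def by blast
  then obtain h where h: "h \<in> ?K" "h \<in> {1..n}" "x h \<in> ball c q" unfolding C1_def by blast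
  have "dist (x h) (x l) \<le> dist c (x h) + dist c (x l)"
    by (metis dist_commute dist_triangle)
  also have "\<dots> \<le> 4 * q" using h c q by auto
  finally have "(h, l) \<in> ?R" using close h l by blast
  then show ?thesis using h by auto
qed

section \<open>Grid cells and Hausdorff measure\<close>

text \<open>Half-open cubes of side \<open>\<rho>\<close>: for \<open>\<rho> > 0\<close> every point
  has exactly one cell index.\<close>

definition grid_cell :: "real \<Rightarrow> int ^ 'd \<Rightarrow> (real ^ 'd) set" where
  "grid_cell \<rho> v = {x. \<forall>i. \<lfloor>x $ i / \<rho>\<rfloor> = v $ i}"

lemma grid_cell_borel [measurable]: "grid_cell \<rho> v \<in> sets borel"
proof -
  have "grid_cell \<rho> v = (\<Inter>i\<in>UNIV. {x. \<lfloor>x $ i / \<rho>\<rfloor> = v $ i})" by (auto simp: grid_cell_def)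
  also have "\<dots> \<in> sets borel"
  proof (rule sets.countable_INT')
    show "(\<lambda>i. {x::real^'a. \<lfloor>x $ i / \<rho>\<rfloor> = v $ i}) ` UNIV \<subseteq> sets borel"
    proof clarify
      fix i
      have "{x::real^'a. \<lfloor>x $ i / \<rho>\<rfloor> = v $ i}
          = {x. real_of_int (v $ i) \<le> x $ i / \<rho>} \<inter> {x. x $ i / \<rho> < real_of_int (v $ i) + 1}"
        by (auto simp: floor_eq_iff)
      moreover have "(\<lambda>x::real^'a. x $ i) \<in> borel_measurable borel"
        by (intro borel_measurable_continuous_onI continuous_intros)
      ultimately show "{x::real^'a. \<lfloor>x $ i / \<rho>\<rfloor> = v $ i} \<in> sets borel" by simp
    qed
  qed auto
  finally show ?thesis .
qed

lemma grid_cell_dist: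
  fixes x y :: "real ^ 'd"
  assumes "0 < \<rho>" "x \<in> grid_cell \<rho> v" "y \<in> grid_cell \<rho> v"
  shows "dist x y \<le> real CARD('d) * \<rho>"
proof -
  have "\<bar>(x - y) $ i\<bar> \<le> \<rho>" for i
  proof -
    have "\<lfloor>x $ i / \<rho>\<rfloor> = \<lfloor>y $ i / \<rho>\<rfloor>" using assms by (simp add: grid_cell_def)
    then have "\<bar>x $ i / \<rho> - y $ i / \<rho>\<bar> \<le> 1" by linarith
    then have "\<bar>(x $ i - y $ i) / \<rho>\<bar> \<le> 1" by (simp add: diff_divide_distrib)
    then show ?thesis using assms(1) by (simp add: abs_divide)
  qed
  then have "(\<Sum>i\<in>UNIV. \<bar>(x - y) $ i\<bar>) \<le> of_nat CARD('d) * \<rho>"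
    by (intro sum_bounded_above) auto
  then show ?thesis using norm_le_l1_cart[of "x - y"] by (simp add: dist_norm)
qed

lemma diameter_grid_cell:
  fixes v :: "int ^ 'd"
  assumes "0 < \<rho>"
  shows "bounded (grid_cell \<rho> v)" "diameter (grid_cell \<rho> v) \<le> real CARD('d) * \<rho>"
proof -
  show "bounded (grid_cell \<rho> v)"
    using grid_cell_dist[OF assms] unfolding bounded_def by (metis empty_iff equals0I)
  show "diameter (grid_cell \<rho> v) \<le> real CARD('d) * \<rho>"
    by (rule diameter_le) (use grid_cell_dist[OF assms] assms in \<open>auto simp: dist_norm\<close>)
qed

lemma card_int_box:
  fixes a :: "'d::finite \<Rightarrow> int"
  shows "finite {w :: int ^ 'd. \<forall>i. a i \<le> w $ i \<and> w $ i < a i + int k}"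
    and "card {w :: int ^ 'd. \<forall>i. a i \<le> w $ i \<and> w $ i < a i + int k} \<le> k ^ CARD('d)"
proof -
  let ?B = "PiE UNIV (\<lambda>i. {a i..<a i + int k})"
  have sub: "{w :: int ^ 'd. \<forall>i. a i \<le> w $ i \<and> w $ i < a i + int k} \<subseteq> vec_lambda ` ?B"
  proof
    fix w :: "int ^ 'd" assume "w \<in> {w. \<forall>i. a i \<le> w $ i \<and> w $ i < a i + int k}"
    then have "vec_nth w \<in> ?B" by auto
    then show "w \<in> vec_lambda ` ?B" by (metis image_eqI vec_nth_inverse)
  qed
  have fin: "finite ?B" by (intro finite_PiE) auto
  then show "finite {w :: int ^ 'd. \<forall>i. a i \<le> w $ i \<and> w $ i < a i + int k}"
    using sub finite_subset by blast
  have "card {w :: int ^ 'd. \<forall>i. a i \<le> w $ i \<and> w $ i < a i + int k} \<le> card (vec_lambda ` ?B)"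
    using sub fin by (intro card_mono) auto
  also have "\<dots> \<le> card ?B" using fin by (rule card_image_le)
  also have "\<dots> = k ^ CARD('d)" by (simp add: card_PiE)
  finally show "card {w :: int ^ 'd. \<forall>i. a i \<le> w $ i \<and> w $ i < a i + int k} \<le> k ^ CARD('d)" .
qed

lemma grid_cell_subdivide:
  fixes v :: "int ^ 'd"
  assumes "0 < \<rho>" "0 < k"
  shows "grid_cell \<rho> v \<subseteq>
    (\<Union>w\<in>{w. \<forall>i. int k * v $ i \<le> w $ i \<and> w $ i < int k * v $ i + int k}. grid_cell (\<rho> / k) w)"
proof
  fix x assume x: "x \<in> grid_cell \<rho> v"
  define w :: "int ^ 'd" where "w = (\<chi> i. \<lfloor>x $ i / (\<rho> / k)\<rfloor>)"
  have "int k * v $ i \<le> w $ i \<and> w $ i < int k * v $ i + int k" for i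
  proof -
    have *: "real_of_int (v $ i) \<le> x $ i / \<rho>" "x $ i / \<rho> < real_of_int (v $ i) + 1"
      using x by (auto simp: grid_cell_def floor_eq_iff)
    have e: "x $ i / (\<rho> / k) = real k * (x $ i / \<rho>)" by simp
    have "real k * real_of_int (v $ i) \<le> x $ i / (\<rho> / k)"
      unfolding e using * assms by (intro mult_left_mono) auto
    moreover have "x $ i / (\<rho> / k) < real k * (real_of_int (v $ i) + 1)"
      unfolding e using * assms by (intro mult_strict_left_mono) auto
    ultimately show ?thesis
      unfolding w_def by (simp add: le_floor_iff floor_less_iff distrib_left)
  qed
  moreover have "x \<in> grid_cell (\<rho> / k) w" by (simp add: grid_cell_def w_def)
  ultimately show "x \<in> (\<Union>w\<in>{w. \<forall>i. int k * v $ i \<le> w $ i \<and> w $ i < int k * v $ i + int k}.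
      grid_cell (\<rho> / k) w)" by blast
qed

text \<open>The sequence of sets in \<open>hausdorff_premeasure\<close> is obtained by padding with
  empty sets, whose gauge is 0.\<close>

lemma hausdorff_premeasure_finite_cover:
  assumes "finite F" "A \<subseteq> \<Union>F" "\<And>U. U \<in> F \<Longrightarrow> bounded U \<and> diameter U \<le> e" "0 \<le> e"
  shows "hausdorff_premeasure s e A \<le> (\<Sum>U\<in>F. hausdorff_gauge s U)"
proof -
  obtain g where g: "bij_betw g {..<card F} F"
    using ex_bij_betw_nat_finite[OF assms(1)] by (auto simp: atLeast0LessThan)
  define U where "U k = (if k < card F then g k else {})" for k
  have gF: "g k \<in> F" if "k < card F" for k using g that by (auto simp: bij_betw_def)
  have cov: "A \<subseteq> (\<Union>k. U k)"
  proof
    fix a assume "a \<in> A"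
    then obtain V where V: "V \<in> F" "a \<in> V" using assms(2) by blast
    then obtain k where "k < card F" "g k = V"
      using bij_betw_imp_surj_on[OF g] by (metis imageE lessThan_iff)
    then show "a \<in> (\<Union>k. U k)" using V by (auto simp: U_def)
  qed
  have "hausdorff_premeasure s e A \<le> (\<Sum>k. hausdorff_gauge s (U k))"
    unfolding hausdorff_premeasure_def
    by (rule INF_lower) (use cov gF assms(3,4) in \<open>simp add: U_def\<close>)
  also have "\<dots> = (\<Sum>k<card F. hausdorff_gauge s (U k))"
    by (rule suminf_finite) (auto simp: U_def hausdorff_gauge_def)
  also have "\<dots> = (\<Sum>k<card F. hausdorff_gauge s (g k))"
    by (rule sum.cong) (auto simp: U_def)
  also have "\<dots> = (\<Sum>U\<in>F. hausdorff_gauge s U)"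
    using sum.reindex_bij_betw[OF g] .
  finally show ?thesis .
qed

lemma hausdorff_gauge_le:
  assumes "0 < s" "diameter U \<le> h" "bounded U"
  shows "hausdorff_gauge s U \<le> ennreal (unit_ball_vol s * (h / 2) powr s)"
  using assms diameter_ge_0[OF assms(3)]
  by (auto simp: hausdorff_gauge_def intro!: ennreal_leI mult_left_mono powr_mono2)

text \<open>A cell of side \<open>\<rho>\<close> splits into at most \<open>k ^ D\<close> cells of
  side \<open>\<rho> / k\<close>, and the powers of \<open>k\<close> cancel in the sum of the
  gauges. The bound is therefore the same at every scale \<open>e\<close> and passes to the
  supremum.\<close>

lemma hausdorff_measure_grid_cell:
  fixes v :: "int ^ 'd"
  assumes "0 < \<rho>"
  defines "D \<equiv> CARD('d)"
  shows "hausdorff_measure D (grid_cell \<rho> v) \<le> ennreal (unit_ball_vol D * (D * \<rho> / 2) ^ D)"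
  unfolding hausdorff_measure_def
proof (rule SUP_least)
  fix e :: real assume e: "e \<in> {0<..}"
  obtain k :: nat where k: "0 < k" "D * \<rho> / k \<le> e"
  proof -
    obtain k :: nat where k: "D * \<rho> / e < k" using reals_Archimedean2 by blast
    have "0 \<le> D * \<rho> / e" using e assms(1) by simp
    then have "0 < k" using k by linarith
    then show ?thesis using that[of k] k e by (auto simp: field_simps)
  qed
  define W where "W = {w. \<forall>i. int k * v $ i \<le> w $ i \<and> w $ i < int k * v $ i + int k}"
  let ?F = "grid_cell (\<rho> / k) ` W"
  have rk: "0 < \<rho> / k" using assms k by simp
  have D: "0 < D" by (simp add: D_def)
  have W: "finite W" "card W \<le> k ^ D" unfolding W_def D_def by (rule card_int_box)+
  have cell: "bounded (grid_cell (\<rho> / k) w) \<and> diameter (grid_cell (\<rho> / k) w) \<le> D * (\<rho> / k)"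
    for w :: "int ^ 'd"
    using diameter_grid_cell[OF rk, of w] by (simp add: D_def)
  have pos: "0 \<le> unit_ball_vol (real D) * (D * (\<rho> / k) / 2) ^ D" using assms k by simp
  have g: "hausdorff_gauge D (grid_cell (\<rho> / k) w)
      \<le> ennreal (unit_ball_vol D * (D * (\<rho> / k) / 2) ^ D)" for w :: "int ^ 'd"
    using hausdorff_gauge_le[of D "grid_cell (\<rho> / k) w" "D * (\<rho> / k)"] cell D assms k
    by (simp add: powr_realpow)
  have "hausdorff_premeasure D e (grid_cell \<rho> v) \<le> (\<Sum>U\<in>?F. hausdorff_gauge D U)"
  proof (rule hausdorff_premeasure_finite_cover)
    show "grid_cell \<rho> v \<subseteq> \<Union> ?F"
      using grid_cell_subdivide[OF assms(1) k(1), of v] by (simp add: W_def)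
    show "bounded U \<and> diameter U \<le> e" if "U \<in> ?F" for U
      using that cell k(2) by (auto intro: order_trans)
  qed (use W e in auto)
  also have "\<dots> \<le> (\<Sum>w\<in>W. hausdorff_gauge D (grid_cell (\<rho> / k) w))"
    using sum_image_le[OF W(1), of "hausdorff_gauge D" "grid_cell (\<rho> / k)"] by simp
  also have "\<dots> \<le> of_nat (card W) * ennreal (unit_ball_vol D * (D * (\<rho> / k) / 2) ^ D)"
    using g by (intro sum_bounded_above) auto
  also have "\<dots> \<le> of_nat (k ^ D) * ennreal (unit_ball_vol D * (D * (\<rho> / k) / 2) ^ D)"
    using W(2) by (intro mult_right_mono) (auto simp only: of_nat_mono zero_le)
  also have "\<dots> = ennreal (real (k ^ D) * (unit_ball_vol D * (D * (\<rho> / k) / 2) ^ D))"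
    using pos by (simp only: ennreal_mult ennreal_of_nat_eq_real_of_nat of_nat_0_le_iff)
  also have "real (k ^ D) * (unit_ball_vol D * (D * (\<rho> / k) / 2) ^ D)
      = unit_ball_vol D * (D * \<rho> / 2) ^ D"
    using k by (simp add: power_divide power_mult_distrib)
  finally show "hausdorff_premeasure D e (grid_cell \<rho> v)
      \<le> ennreal (unit_ball_vol D * (D * \<rho> / 2) ^ D)" .
qed

text \<open>Reals at distance at most 1 have floors that differ by at most 1. A step of a chain thus
  has only \<open>3 ^ CARD('d)\<close> possible cell offsets.\<close>

lemma grid_cell_neighbour:
  fixes x y :: "real ^ 'd"
  assumes "0 < \<rho>" "norm (x - y) \<le> \<rho>" "x \<in> grid_cell \<rho> v" "y \<in> grid_cell \<rho> w"
  shows "\<bar>(w - v) $ i\<bar> \<le> 1"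
proof -
  have "\<bar>(y - x) $ i\<bar> \<le> \<rho>"
    using component_le_norm_cart[of "y - x" i] assms(2) by (simp add: norm_minus_commute)
  then have "\<bar>(y $ i - x $ i) / \<rho>\<bar> \<le> 1" using assms(1) by (simp add: abs_divide)
  then have "\<bar>y $ i / \<rho> - x $ i / \<rho>\<bar> \<le> 1" by (simp add: diff_divide_distrib)
  moreover have "w $ i = \<lfloor>y $ i / \<rho>\<rfloor>" "v $ i = \<lfloor>x $ i / \<rho>\<rfloor>"
    using assms by (auto simp: grid_cell_def)
  ultimately show ?thesis by simp linarith
qed

section \<open>Nets and supports of measures\<close>

text \<open>A largest \<open>q\<close>-separated subset of \<open>S\<close> is a
  \<open>q\<close>-net. The balls of radius \<open>q / 2\<close> around separated points are
  disjoint and have mass at least \<open>p\<close>, which bounds their number and so makes a largest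
  subset exist.\<close>

lemma finite_net_of_lower_density:
  fixes \<mu> :: "'a::{metric_space, second_countable_topology} measure"
  assumes "prob_space \<mu>" "sets \<mu> = sets borel" "S \<in> sets borel" "0 < q" "0 < p"
    and dens: "\<And>x. x \<in> S \<Longrightarrow> p \<le> measure \<mu> (S \<inter> ball x (q / 2))"
  obtains C where "finite C" "C \<subseteq> S" "S \<subseteq> (\<Union>c\<in>C. ball c q)" "real (card C) \<le> 1 / p"
proof -
  interpret prob_space \<mu> by fact
  define sep where "sep C \<longleftrightarrow> finite C \<and> C \<subseteq> S \<and> (\<forall>c\<in>C. \<forall>c'\<in>C. c \<noteq> c' \<longrightarrow> q \<le> dist c c')"
    for C
  have card_le: "real (card C) \<le> 1 / p" if "sep C" for C
  proof -
    have C: "finite C" "C \<subseteq> S" "\<And>c c'. c \<in> C \<Longrightarrow> c' \<in> C \<Longrightarrow> c \<noteq> c' \<Longrightarrow> q \<le> dist c c'"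
      using that by (auto simp: sep_def)
    have "disjoint_family_on (\<lambda>c. S \<inter> ball c (q / 2)) C"
      unfolding disjoint_family_on_def
    proof (intro ballI impI)
      fix c c' assume c: "c \<in> C" "c' \<in> C" "c \<noteq> c'"
      have "ball c (q / 2) \<inter> ball c' (q / 2) = {}"
        by (rule disjoint_ballI) (use C(3)[OF c] in simp)
      then show "S \<inter> ball c (q / 2) \<inter> (S \<inter> ball c' (q / 2)) = {}" by blast
    qed
    then have "(\<Sum>c\<in>C. prob (S \<inter> ball c (q / 2))) = prob (\<Union>c\<in>C. S \<inter> ball c (q / 2))"
      using C assms by (intro finite_measure_finite_Union[symmetric]) auto
    then have "(\<Sum>c\<in>C. prob (S \<inter> ball c (q / 2))) \<le> 1" by simp
    moreover have "of_nat (card C) * p \<le> (\<Sum>c\<in>C. prob (S \<inter> ball c (q / 2)))"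
      using dens C by (intro sum_bounded_below) auto
    ultimately have "real (card C) * p \<le> 1" by simp
    then show ?thesis using assms(5) by (simp add: field_simps)
  qed
  have "sep {}" by (simp add: sep_def)
  moreover have "\<forall>C. sep C \<longrightarrow> card C < Suc (nat \<lfloor>1 / p\<rfloor>)"
    using card_le assms(5) by (auto simp: less_Suc_eq_le le_nat_floor)
  ultimately obtain C where C: "sep C" "\<And>C'. sep C' \<Longrightarrow> card C' \<le> card C"
    using ex_has_greatest_nat[of sep "{}" card] by blast
  have "S \<subseteq> (\<Union>c\<in>C. ball c q)"
  proof
    fix x assume x: "x \<in> S"
    show "x \<in> (\<Union>c\<in>C. ball c q)"
    proof (rule ccontr)
      assume far: "x \<notin> (\<Union>c\<in>C. ball c q)"
      then have "sep (insert x C)" using C(1) x by (auto simp: sep_def dist_commute not_less)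
      then have "card (insert x C) \<le> card C" using C(2) by blast
      moreover have "x \<notin> C" using far assms(4) by auto
      ultimately show False using C(1) by (simp add: sep_def)
    qed
  qed
  then show ?thesis using that C(1) card_le[OF C(1)] by (auto simp: sep_def)
qed

lemma measure_support_closed: "closed (measure_support \<mu>)"
proof -
  have "- measure_support \<mu> = \<Union>{U. open U \<and> emeasure \<mu> U = 0}"
    by (auto simp: measure_support_def zero_less_iff_neq_zero)
  also have "open \<dots>" by auto
  finally show ?thesis by (simp add: closed_def)
qed

text \<open>The complement of the support is a union of possibly uncountably many open null sets; by
  Lindelof a countable subfamily has the same union.\<close>

lemma measure_support_prob:
  fixes \<mu> :: "'a::second_countable_topology measure"
  assumes "prob_space \<mu>" "sets \<mu> = sets borel"
  shows "measure \<mu> (measure_support \<mu>) = 1"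
proof -
  interpret prob_space \<mu> by fact
  define \<U> where "\<U> = {U. open U \<and> emeasure \<mu> U = 0}"
  obtain \<V> where V: "\<V> \<subseteq> \<U>" "countable \<V>" "\<Union>\<V> = \<Union>\<U>"
    using Lindelof[of \<U>] by (auto simp: \<U>_def)
  have "- measure_support \<mu> = \<Union>\<U>"
    by (auto simp: \<U>_def measure_support_def zero_less_iff_neq_zero)
  moreover have "emeasure \<mu> (\<Union>\<V>) = 0"
  proof -
    have "(\<Union>U\<in>\<V>. U) \<in> null_sets \<mu>"
      using V by (intro null_sets_UN') (auto simp: \<U>_def assms(2) intro!: null_setsI)
    then show ?thesis by auto
  qed
  ultimately have "prob (- measure_support \<mu>) = 0" using V by (simp add: measure_def)
  moreover have "measure_support \<mu> \<in> sets \<mu>" using borel_closed[OF measure_support_closed] assms(2) by simp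
  ultimately show ?thesis
    using prob_compl[of "measure_support \<mu>"] sets_eq_imp_space_eq[OF assms(2)]
    by (simp add: Compl_eq_Diff_UNIV)
qed

section \<open>Bad events\<close>

text \<open>\<open>restrict\<close> matches the offset sequences of the chain encoding, which are
  taken from a \<open>PiE\<close> in order to be counted.\<close>

lemma path_eq_start_plus_offsets:
  fixes v :: "nat \<Rightarrow> 'a::ab_group_add"
  assumes "j < m"
  shows "v j = v 0 + (\<Sum>i<j. restrict (\<lambda>i. v (Suc i) - v i) {..<m} i)"
proof -
  have "(\<Sum>i<j. restrict (\<lambda>i. v (Suc i) - v i) {..<m} i) = (\<Sum>i<j. v (Suc i) - v i)"
    using assms by (intro sum.cong) auto
  then show ?thesis by (simp add: sum_lessThan_telescope)
qed

text \<open>Interface between the model and the bad events: the mixture enters only through a lower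
  density on the supports with the common exponent \<open>d\<close>, an upper bound for an outlier
  in one cell, the class masses \<open>p\<close>, and the gap \<open>g\<close> in the size
  inequality for these masses. When the locale is instantiated, the mixture weights of the supports
  are absorbed in \<open>c\<close>.\<close>

locale outlier_sample = prob_space \<Omega> for \<Omega> :: "'w measure" +
  fixes X :: "nat \<Rightarrow> 'w \<Rightarrow> real ^ 'd" and n M :: nat and S :: "nat \<Rightarrow> (real ^ 'd) set"
    and p :: "nat \<Rightarrow> real" and d c r1 \<delta> K \<epsilon> g :: real
  assumes n: "1 \<le> n" and M: "2 \<le> M"
    and indep: "indep_vars (\<lambda>_. borel) X {1..n}"
    and cube: "\<And>k \<omega>. k \<in> {1..n} \<Longrightarrow> \<omega> \<in> space \<Omega> \<Longrightarrow> X k \<omega> \<in> unit_cube"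
    and S_borel: "\<And>i. i \<in> {0..M} \<Longrightarrow> S i \<in> sets borel"
    and S_cover: "unit_cube \<subseteq> (\<Union>i\<in>{0..M}. S i)"
    and S_disjoint: "\<And>i j. i \<in> {0..M} \<Longrightarrow> j \<in> {0..M} \<Longrightarrow> i \<noteq> j \<Longrightarrow> S i \<inter> S j = {}"
    and S_connected: "\<And>i. i \<in> {1..M} \<Longrightarrow> connected (S i)"
    and S_far: "\<And>i j x y. i \<in> {1..M} \<Longrightarrow> j \<in> {1..M} \<Longrightarrow> i \<noteq> j \<Longrightarrow> x \<in> S i \<Longrightarrow> y \<in> S j \<Longrightarrow>
          \<delta> \<le> dist x y"
    and lower: "\<And>k i x r. k \<in> {1..n} \<Longrightarrow> i \<in> {1..M} \<Longrightarrow> x \<in> S i \<Longrightarrow> 0 < r \<Longrightarrow> r \<le> r1 \<Longrightarrow>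
          c * r powr d \<le> prob (X k -` (S i \<inter> ball x r) \<inter> space \<Omega>)"
    and upper: "\<And>k \<rho> v. k \<in> {1..n} \<Longrightarrow> 0 < \<rho> \<Longrightarrow>
          prob (X k -` (S 0 \<inter> grid_cell \<rho> v) \<inter> space \<Omega>) \<le> \<epsilon> * K * \<rho> ^ CARD('d)"
    and mass: "\<And>k i. k \<in> {1..n} \<Longrightarrow> i \<in> {0..M} \<Longrightarrow> prob (X k -` S i \<inter> space \<Omega>) = p i"
    and gap: "\<And>i j. i \<in> {1..M} \<Longrightarrow> j \<in> {1..M} \<Longrightarrow> g \<le> 2 * p i - p j - p 0"
    and pos: "0 < c" "0 < g" "0 \<le> \<epsilon>" "0 \<le> K"
begin

lemma X_measurable: "k \<in> {1..n} \<Longrightarrow> random_variable borel (X k)"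
  using indep unfolding indep_vars_def by blast

lemma event_in: "k \<in> {1..n} \<Longrightarrow> A \<in> sets borel \<Longrightarrow> {\<omega> \<in> space \<Omega>. X k \<omega> \<in> A} \<in> events"
  using measurable_sets[OF X_measurable, of k A] by (simp add: vimage_def Int_def conj_commute)

lemma events_all_in:
  assumes "J \<subseteq> {1..n}" "\<And>k. k \<in> J \<Longrightarrow> A k \<in> sets borel"
  shows "{\<omega> \<in> space \<Omega>. \<forall>k\<in>J. X k \<omega> \<in> A k} \<in> events"
  by (rule sets.sets_Collect_finite_All)
    (use assms event_in finite_subset[OF assms(1)] in auto)

lemma prob_all_in:
  assumes "J \<subseteq> {1..n}" "\<And>k. k \<in> J \<Longrightarrow> A k \<in> sets borel"
  shows "prob {\<omega> \<in> space \<Omega>. \<forall>k\<in>J. X k \<omega> \<in> A k} = (\<Prod>k\<in>J. prob (X k -` A k \<inter> space \<Omega>))"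
proof (cases "J = {}")
  case False
  have "{\<omega> \<in> space \<Omega>. \<forall>k\<in>J. X k \<omega> \<in> A k} = (\<Inter>k\<in>J. X k -` A k \<inter> space \<Omega>)"
    using False by auto
  then show ?thesis
    using indep_varsD[OF indep False finite_subset[OF assms(1)] assms(1), of A] assms(2) by simp
qed (simp add: prob_space)

section \<open>Empty balls of a net\<close>

lemma prob_all_miss:
  assumes "B \<in> sets borel" "\<And>k. k \<in> {1..n} \<Longrightarrow> a \<le> prob (X k -` B \<inter> space \<Omega>)"
  shows "prob {\<omega> \<in> space \<Omega>. \<forall>k\<in>{1..n}. X k \<omega> \<in> - B} \<le> exp (- (real n * a))"
proof -
  have "prob {\<omega> \<in> space \<Omega>. \<forall>k\<in>{1..n}. X k \<omega> \<in> - B}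
      = (\<Prod>k\<in>{1..n}. prob (X k -` (- B) \<inter> space \<Omega>))"
    using assms(1) by (intro prob_all_in) auto
  also have "\<dots> \<le> (\<Prod>k\<in>{1..n}. exp (- a))"
  proof (intro prod_mono conjI measure_nonneg)
    fix k assume k: "k \<in> {1..n}"
    have "X k -` (- B) \<inter> space \<Omega> = space \<Omega> - (X k -` B \<inter> space \<Omega>)" by auto
    then have "prob (X k -` (- B) \<inter> space \<Omega>) = 1 - prob (X k -` B \<inter> space \<Omega>)"
      using prob_compl measurable_sets[OF X_measurable[OF k] assms(1)] by simp
    also have "\<dots> \<le> 1 + - a" using assms(2)[OF k] by simp
    also have "\<dots> \<le> exp (- a)" by (rule exp_ge_add_one_self)
    finally show "prob (X k -` (- B) \<inter> space \<Omega>) \<le> exp (- a)" .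
  qed
  also have "\<dots> = exp (- (real n * a))" by (simp flip: exp_of_nat_mult)
  finally show ?thesis .
qed

definition missed_ball :: "(nat \<Rightarrow> (real ^ 'd) set) \<Rightarrow> real \<Rightarrow> 'w set" where
  "missed_ball C q = (\<Union>i\<in>{1..M}. \<Union>z\<in>C i.
     {\<omega> \<in> space \<Omega>. \<forall>k\<in>{1..n}. X k \<omega> \<in> - (S i \<inter> ball z q)})"

lemma net_exists:
  assumes "0 < q" "q \<le> r1"
  obtains C where "\<And>i. i \<in> {1..M} \<Longrightarrow> finite (C i)" "\<And>i. i \<in> {1..M} \<Longrightarrow> C i \<subseteq> S i"
    "\<And>i. i \<in> {1..M} \<Longrightarrow> S i \<subseteq> (\<Union>z\<in>C i. ball z q)"
    "\<And>i. i \<in> {1..M} \<Longrightarrow> real (card (C i)) \<le> 1 / (c * (q / 2) powr d)"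
proof -
  have "\<exists>C. finite C \<and> C \<subseteq> S i \<and> S i \<subseteq> (\<Union>z\<in>C. ball z q) \<and>
      real (card C) \<le> 1 / (c * (q / 2) powr d)" if i: "i \<in> {1..M}" for i
  proof -
    have 1: "(1::nat) \<in> {1..n}" using n by simp
    have Si: "S i \<in> sets borel" using S_borel i by simp
    \<comment> \<open>All observations obey the same lower bound, so the law of \<open>X 1\<close>
      can serve as the reference measure. The net is deterministic, which the union bound over its
      balls requires.\<close>
    show ?thesis
    proof (rule finite_net_of_lower_density[of "distr \<Omega> borel (X 1)" "S i" q "c * (q / 2) powr d"])
      show "prob_space (distr \<Omega> borel (X 1))" by (rule prob_space_distr[OF X_measurable[OF 1]])
      show "c * (q / 2) powr d \<le> measure (distr \<Omega> borel (X 1)) (S i \<inter> ball x (q / 2))"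
        if "x \<in> S i" for x
        using lower[OF 1 i that, of "q / 2"] assms Si
        by (subst measure_distr[OF X_measurable[OF 1]]) auto
    qed (use assms pos Si in auto)
  qed
  then show ?thesis using that by metis
qed

text \<open>The number of balls comes from disjoint balls of radius \<open>q / 2\<close>, the
  exponent from \<open>n\<close> independent misses of a ball of radius \<open>q\<close>; hence the
  two radii.\<close>

lemma prob_missed_ball:
  assumes q: "0 < q" "q \<le> r1"
    and C: "\<And>i. i \<in> {1..M} \<Longrightarrow> finite (C i)" "\<And>i. i \<in> {1..M} \<Longrightarrow> C i \<subseteq> S i"
      "\<And>i. i \<in> {1..M} \<Longrightarrow> real (card (C i)) \<le> 1 / (c * (q / 2) powr d)"
  shows "missed_ball C q \<in> events"
    and "prob (missed_ball C q)
      \<le> real M * (1 / (c * (q / 2) powr d)) * exp (- (real n * (c * q powr d)))"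
proof -
  let ?E = "\<lambda>i z. {\<omega> \<in> space \<Omega>. \<forall>k\<in>{1..n}. X k \<omega> \<in> - (S i \<inter> ball z q)}"
  have ev: "?E i z \<in> events" if "i \<in> {1..M}" for i z
    using S_borel[of i] that by (intro events_all_in) auto
  show "missed_ball C q \<in> events"
    unfolding missed_ball_def using ev C(1) by (intro sets.finite_UN) auto
  have "prob (missed_ball C q) \<le> (\<Sum>i\<in>{1..M}. prob (\<Union>z\<in>C i. ?E i z))"
    unfolding missed_ball_def using ev C(1)
    by (intro finite_measure_subadditive_finite) (auto intro!: sets.finite_UN)
  also have "\<dots> \<le> (\<Sum>i\<in>{1..M}. 1 / (c * (q / 2) powr d) * exp (- (real n * (c * q powr d))))"
  proof (rule sum_mono)
    fix i assume i: "i \<in> {1..M}"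
    have "prob (\<Union>z\<in>C i. ?E i z) \<le> (\<Sum>z\<in>C i. prob (?E i z))"
      using ev[OF i] C(1)[OF i] by (intro finite_measure_subadditive_finite) auto
    also have "\<dots> \<le> of_nat (card (C i)) * exp (- (real n * (c * q powr d)))"
    proof (rule sum_bounded_above)
      fix z assume z: "z \<in> C i"
      show "prob (?E i z) \<le> exp (- (real n * (c * q powr d)))"
        using lower[OF _ i, of _ z q] C(2)[OF i] z q S_borel[of i] i by (intro prob_all_miss) auto
    qed
    also have "\<dots> \<le> 1 / (c * (q / 2) powr d) * exp (- (real n * (c * q powr d)))"
      using C(3)[OF i] by (intro mult_right_mono) auto
    finally show "prob (\<Union>z\<in>C i. ?E i z)
        \<le> 1 / (c * (q / 2) powr d) * exp (- (real n * (c * q powr d)))" .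
  qed
  finally show "prob (missed_ball C q)
      \<le> real M * (1 / (c * (q / 2) powr d)) * exp (- (real n * (c * q powr d)))" by simp
qed

section \<open>Chains of outliers\<close>

text \<open>
  A chain of \<open>m\<close> outliers is encoded by its distinct indices, the grid cell of its first point and
  the successive cell offsets, each of which has coordinates in \<open>{-1, 0, 1}\<close>. Fixing the cells
  turns a chain into independent constraints on the single observations.
\<close>

definition chain_index :: "nat \<Rightarrow> real \<Rightarrow> ((nat \<Rightarrow> nat) \<times> (int ^ 'd) \<times> (nat \<Rightarrow> int ^ 'd)) set" where
  "chain_index m \<rho> = {f \<in> PiE {..<m} (\<lambda>_. {1..n}). inj_on f {..<m}} \<times>
     {v. \<forall>i. 0 \<le> v $ i \<and> v $ i < 0 + int (Suc (nat \<lfloor>1 / \<rho>\<rfloor>))} \<times>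
     PiE {..<m} (\<lambda>_. {u. \<forall>i. -1 \<le> u $ i \<and> u $ i < -1 + int 3})"

text \<open>Counting \<open>m\<close> offsets for the \<open>m - 1\<close> steps of a chain makes
  the factor \<open>3 ^ CARD('d)\<close> part of the base of an \<open>m\<close>-th power.\<close>

lemma card_chain_index:
  "finite (chain_index m \<rho>)"
  "card (chain_index m \<rho>) \<le> n ^ m * (Suc (nat \<lfloor>1 / \<rho>\<rfloor>) ^ CARD('d) * (3 ^ CARD('d)) ^ m)"
proof -
  let ?F = "{f \<in> PiE {..<m} (\<lambda>_. {1..n}). inj_on f {..<m}}"
  let ?O = "PiE {..<m} (\<lambda>_. {u :: int ^ 'd. \<forall>i. -1 \<le> u $ i \<and> u $ i < -1 + int 3})"
  note box = card_int_box[of "\<lambda>_::'d. 0" "Suc (nat \<lfloor>1 / \<rho>\<rfloor>)"] card_int_box[of "\<lambda>_::'d. -1" 3]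
  have F: "finite (PiE {..<m} (\<lambda>_. {1..n}))" by (intro finite_PiE) auto
  have "card ?F \<le> card (PiE {..<m} (\<lambda>_. {1..n}))" using F by (intro card_mono) auto
  then have cF: "card ?F \<le> n ^ m" by (simp add: card_PiE)
  have fO: "finite ?O" using box(3) by (intro finite_PiE) auto
  have cO: "card ?O \<le> (3 ^ CARD('d)) ^ m"
    using power_mono[OF box(4), of m] by (simp add: card_PiE)
  show "finite (chain_index m \<rho>)"
    unfolding chain_index_def using F fO box(1) by (intro finite_cartesian_product) auto
  show "card (chain_index m \<rho>) \<le> n ^ m * (Suc (nat \<lfloor>1 / \<rho>\<rfloor>) ^ CARD('d) * (3 ^ CARD('d)) ^ m)"
    unfolding chain_index_def card_cartesian_product using cF cO box(2) by (intro mult_le_mono)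
qed

text \<open>The constraints are indexed by observations instead of positions, since independence is
  applied to a set of indices; \<open>the_inv_into\<close> recovers the position in the
  chain.\<close>

definition chain_event ::
    "nat \<Rightarrow> real \<Rightarrow> (nat \<Rightarrow> nat) \<times> (int ^ 'd) \<times> (nat \<Rightarrow> int ^ 'd) \<Rightarrow> 'w set" where
  "chain_event m \<rho> = (\<lambda>(f, v, u). {\<omega> \<in> space \<Omega>. \<forall>k\<in>f ` {..<m}.
     X k \<omega> \<in> S 0 \<inter> grid_cell \<rho> (v + (\<Sum>i<the_inv_into {..<m} f k. u i))})"

text \<open>Injectivity of \<open>f\<close> makes the constraints concern \<open>m\<close> different
  observations, so the product has exactly \<open>m\<close> factors.\<close>

lemma prob_chain_event:
  assumes "0 < \<rho>" "t \<in> chain_index m \<rho>"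
  shows "chain_event m \<rho> t \<in> events" "prob (chain_event m \<rho> t) \<le> (\<epsilon> * K * \<rho> ^ CARD('d)) ^ m"
proof -
  obtain f v u where t: "t = (f, v, u)" by (cases t)
  have f: "f ` {..<m} \<subseteq> {1..n}" "inj_on f {..<m}" using assms(2) by (auto simp: t chain_index_def)
  have b: "S 0 \<inter> grid_cell \<rho> w \<in> sets borel" for w using S_borel[of 0] by simp
  show "chain_event m \<rho> t \<in> events"
    unfolding chain_event_def t prod.case by (rule events_all_in[OF f(1) b])
  have "prob (chain_event m \<rho> t) = (\<Prod>k\<in>f ` {..<m}.
      prob (X k -` (S 0 \<inter> grid_cell \<rho> (v + (\<Sum>i<the_inv_into {..<m} f k. u i))) \<inter> space \<Omega>))"
    unfolding chain_event_def t prod.case by (rule prob_all_in[OF f(1) b])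
  also have "\<dots> \<le> (\<Prod>k\<in>f ` {..<m}. \<epsilon> * K * \<rho> ^ CARD('d))"
    using upper f(1) assms(1) by (intro prod_mono conjI measure_nonneg) auto
  also have "\<dots> = (\<epsilon> * K * \<rho> ^ CARD('d)) ^ m" using card_image[OF f(2)] by simp
  finally show "prob (chain_event m \<rho> t) \<le> (\<epsilon> * K * \<rho> ^ CARD('d)) ^ m" .
qed

lemma chain_in_chain_event:
  assumes "0 < \<rho>" "\<omega> \<in> space \<Omega>" "1 \<le> m"
    and f: "inj_on f {..<m}" "\<And>j. j < m \<Longrightarrow> f j \<in> {1..n} \<and> X (f j) \<omega> \<in> S 0"
    and step: "\<And>j. Suc j < m \<Longrightarrow> norm (X (f j) \<omega> - X (f (Suc j)) \<omega>) \<le> \<rho>"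
  shows "\<omega> \<in> (\<Union>t\<in>chain_index m \<rho>. chain_event m \<rho> t)"
proof -
  define v where "v j = (\<chi> i. \<lfloor>X (f j) \<omega> $ i / \<rho>\<rfloor>)" for j
  \<comment> \<open>Positions are clamped at \<open>m - 1\<close>, so the last offset is 0 and
    within the allowed range, whatever \<open>f\<close> is beyond the chain.\<close>
  define w where "w j = v (min j (m - 1))" for j
  have w: "X (f j) \<omega> \<in> grid_cell \<rho> (w j)" if "j < m" for j
  proof -
    have "min j (m - 1) = j" using that by simp
    then show ?thesis using that by (simp add: w_def v_def grid_cell_def)
  qed
  define u where "u = restrict (\<lambda>i. w (Suc i) - w i) {..<m}"
  define f' where "f' = restrict f {..<m}"
  have abs: "\<bar>w (Suc j) $ i - w j $ i\<bar> \<le> 1" for j i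
  proof (cases "Suc j < m")
    case True
    then show ?thesis
      using grid_cell_neighbour[OF assms(1) step[OF True] w w] by simp
  next
    case False
    then have "min (Suc j) (m - 1) = min j (m - 1)" by simp
    then show ?thesis by (simp add: w_def)
  qed
  have "-1 \<le> w (Suc j) $ i - w j $ i" "w (Suc j) $ i - w j $ i < 2" for j i
    using abs[of j i] by linarith+
  then have u: "u \<in> PiE {..<m} (\<lambda>_. {u. \<forall>i. -1 \<le> u $ i \<and> u $ i < -1 + int 3})"
    by (auto simp: u_def)
  have w0: "0 \<le> w 0 $ i \<and> w 0 $ i < 0 + int (Suc (nat \<lfloor>1 / \<rho>\<rfloor>))" for i
  proof -
    have "X (f 0) \<omega> \<in> unit_cube" using cube f(2)[of 0] assms by simp
    then have x: "0 \<le> X (f 0) \<omega> $ i" "X (f 0) \<omega> $ i \<le> 1" by (auto simp: unit_cube_def)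
    have "w 0 $ i = \<lfloor>X (f 0) \<omega> $ i / \<rho>\<rfloor>" using w[of 0] assms(3) by (simp add: grid_cell_def)
    moreover have "0 \<le> X (f 0) \<omega> $ i / \<rho>" "X (f 0) \<omega> $ i / \<rho> \<le> 1 / \<rho>"
      using x assms(1) by (auto simp: divide_right_mono)
    ultimately have "0 \<le> w 0 $ i" "w 0 $ i \<le> \<lfloor>1 / \<rho>\<rfloor>" by (auto intro: floor_mono)
    then show ?thesis using assms(1) by simp
  qed
  have "f' \<in> PiE {..<m} (\<lambda>_. {1..n})" using f(2) by (auto simp: f'_def)
  moreover have inj': "inj_on f' {..<m}" using f(1) by (simp add: f'_def inj_on_def)
  ultimately have "(f', w 0, u) \<in> chain_index m \<rho>"
    unfolding chain_index_def using u w0 by auto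
  moreover have "\<omega> \<in> chain_event m \<rho> (f', w 0, u)"
    unfolding chain_event_def prod.case
  proof (intro CollectI conjI ballI assms)
    fix k assume "k \<in> f' ` {..<m}"
    then obtain j where j: "j < m" "k = f' j" by auto
    have "the_inv_into {..<m} f' k = j" using the_inv_into_f_f[OF inj'] j by simp
    moreover have "w 0 + (\<Sum>i<j. u i) = w j"
      using path_eq_start_plus_offsets[OF j(1), of w] by (simp add: u_def)
    ultimately show "X k \<omega> \<in> S 0 \<inter> grid_cell \<rho> (w 0 + (\<Sum>i<the_inv_into {..<m} f' k. u i))"
      using w f(2) j by (simp add: f'_def)
  qed
  ultimately show ?thesis by blast
qed

text \<open>The size of \<open>chain_index\<close> times the bound for one encoding. The hypothesis
  \<open>\<rho> \<le> 1\<close> turns \<open>1 / \<rho> + 1\<close> starting cells per coordinate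
  into \<open>2 / \<rho>\<close>.\<close>

lemma prob_chain:
  assumes "0 < \<rho>" "\<rho> \<le> 1"
  shows "(\<Union>t\<in>chain_index m \<rho>. chain_event m \<rho> t) \<in> events"
    and "prob (\<Union>t\<in>chain_index m \<rho>. chain_event m \<rho> t)
      \<le> (2 / \<rho>) ^ CARD('d) * (3 ^ CARD('d) * K * (real n * \<epsilon> * \<rho> ^ CARD('d))) ^ m"
proof -
  let ?b = "\<epsilon> * K * \<rho> ^ CARD('d)"
  have b: "0 \<le> ?b" using pos assms by simp
  show "(\<Union>t\<in>chain_index m \<rho>. chain_event m \<rho> t) \<in> events"
    using card_chain_index(1) prob_chain_event(1)[OF assms(1)] by (intro sets.finite_UN) auto
  have "prob (\<Union>t\<in>chain_index m \<rho>. chain_event m \<rho> t)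
      \<le> (\<Sum>t\<in>chain_index m \<rho>. prob (chain_event m \<rho> t))"
    using card_chain_index(1) prob_chain_event(1)[OF assms(1)]
    by (intro finite_measure_subadditive_finite) auto
  also have "\<dots> \<le> of_nat (card (chain_index m \<rho>)) * ?b ^ m"
    using prob_chain_event(2)[OF assms(1)] by (intro sum_bounded_above) auto
  also have "\<dots> \<le> real (n ^ m * (Suc (nat \<lfloor>1 / \<rho>\<rfloor>) ^ CARD('d) * (3 ^ CARD('d)) ^ m)) * ?b ^ m"
    using card_chain_index(2)[of m \<rho>] b by (intro mult_right_mono) (auto simp only: of_nat_mono zero_le_power)
  also have "\<dots> = real (Suc (nat \<lfloor>1 / \<rho>\<rfloor>)) ^ CARD('d)
      * (3 ^ CARD('d) * K * (real n * \<epsilon> * \<rho> ^ CARD('d))) ^ m"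
    by (simp only: of_nat_mult of_nat_power of_nat_numeral power_mult_distrib mult_ac)
  also have "\<dots> \<le> (2 / \<rho>) ^ CARD('d) * (3 ^ CARD('d) * K * (real n * \<epsilon> * \<rho> ^ CARD('d))) ^ m"
  proof (intro mult_right_mono power_mono)
    have "1 \<le> 1 / \<rho>" using assms by simp
    moreover have "real (nat \<lfloor>1 / \<rho>\<rfloor>) \<le> 1 / \<rho>" using assms by simp
    ultimately show "real (Suc (nat \<lfloor>1 / \<rho>\<rfloor>)) \<le> 2 / \<rho>" by simp
  qed (use pos assms in auto)
  finally show "prob (\<Union>t\<in>chain_index m \<rho>. chain_event m \<rho> t)
      \<le> (2 / \<rho>) ^ CARD('d) * (3 ^ CARD('d) * K * (real n * \<epsilon> * \<rho> ^ CARD('d))) ^ m" .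
qed

section \<open>Sizes of the classes\<close>

text \<open>Its sum over the sample is \<open>2 * N i - N j - N 0\<close>, so the size condition is
  the positivity of a sum of independent variables with values in [-2, 2].\<close>

definition class_score :: "nat \<Rightarrow> nat \<Rightarrow> real ^ 'd \<Rightarrow> real" where
  "class_score i j x = 2 * indicator (S i) x - indicator (S j) x - indicator (S 0) x"

lemma sum_indicator_card:
  "(\<Sum>k\<in>{1..n}. indicator A (X k \<omega>)) = real (card {k \<in> {1..n}. X k \<omega> \<in> A})"
proof -
  have "(\<Sum>k\<in>{1..n}. indicator A (X k \<omega>) :: real)
      = (\<Sum>k\<in>{1..n}. if k \<in> {k \<in> {1..n}. X k \<omega> \<in> A} then 1 else 0)"
    by (intro sum.cong) (auto simp: indicator_def)
  also have "\<dots> = (\<Sum>k\<in>{1..n} \<inter> {k \<in> {1..n}. X k \<omega> \<in> A}. 1)"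
    by (rule sum.inter_restrict[symmetric]) simp
  also have "{1..n} \<inter> {k \<in> {1..n}. X k \<omega> \<in> A} = {k \<in> {1..n}. X k \<omega> \<in> A}" by blast
  finally show ?thesis by simp
qed

text \<open>Hoeffding's inequality for a deviation equal to the whole mean, which is at least n g.
  The squared ranges add up to 16 n, whence the exponent 2 (n g)^2 / (16 n) = g^2 n / 8.\<close>

lemma prob_class_score:
  assumes i: "i \<in> {1..M}" and j: "j \<in> {1..M}"
  shows "{\<omega> \<in> space \<Omega>. (\<Sum>k\<in>{1..n}. class_score i j (X k \<omega>)) \<le> 0} \<in> events"
    and "prob {\<omega> \<in> space \<Omega>. (\<Sum>k\<in>{1..n}. class_score i j (X k \<omega>)) \<le> 0}
      \<le> exp (- (g\<^sup>2 / 8 * real n))"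
proof -
  have ij: "i \<in> {0..M}" "j \<in> {0..M}" "0 \<in> {0..M}" using i j by auto
  have ms: "class_score i j \<in> borel_measurable borel"
    unfolding class_score_def
    using S_borel[OF ij(1)] S_borel[OF ij(2)] S_borel[OF ij(3)] by measurable
  have mX: "(\<lambda>\<omega>. class_score i j (X k \<omega>)) \<in> borel_measurable \<Omega>" if "k \<in> {1..n}" for k
    using measurable_compose[OF X_measurable[OF that] ms] .
  have "(\<lambda>\<omega>. \<Sum>k\<in>{1..n}. class_score i j (X k \<omega>)) \<in> borel_measurable \<Omega>"
    using mX by (intro borel_measurable_sum) auto
  then show "{\<omega> \<in> space \<Omega>. (\<Sum>k\<in>{1..n}. class_score i j (X k \<omega>)) \<le> 0} \<in> events"
    by simp
  interpret H: Hoeffding_ineq \<Omega> "{1..n}" "\<lambda>k \<omega>. class_score i j (X k \<omega>)" "\<lambda>_. -2" "\<lambda>_. 2"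
    "\<Sum>k\<in>{1..n}. expectation (\<lambda>\<omega>. class_score i j (X k \<omega>))"
  proof unfold_locales
    show "indep_vars (\<lambda>_. borel) (\<lambda>k \<omega>. class_score i j (X k \<omega>)) {1..n}"
      using indep_vars_compose2[OF indep, of "\<lambda>_. class_score i j"] ms by simp
  qed (auto simp: class_score_def indicator_def)
  define \<mu> where "\<mu> = (\<Sum>k\<in>{1..n}. expectation (\<lambda>\<omega>. class_score i j (X k \<omega>)))"
  have ind: "expectation (\<lambda>\<omega>. indicator (S h) (X k \<omega>)) = p h"
      "integrable \<Omega> (\<lambda>\<omega>. indicator (S h) (X k \<omega>) :: real)"
    if "h \<in> {0..M}" "k \<in> {1..n}" for h k
  proof -
    have ev: "X k -` S h \<inter> space \<Omega> \<in> events"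
      using measurable_sets[OF X_measurable[OF that(2)] S_borel[OF that(1)]] .
    have eq: "\<omega> \<in> space \<Omega> \<Longrightarrow>
        indicator (S h) (X k \<omega>) = (indicator (X k -` S h \<inter> space \<Omega>) \<omega> :: real)" for \<omega>
      by (simp add: indicator_def)
    have "expectation (\<lambda>\<omega>. indicator (S h) (X k \<omega>) :: real)
        = expectation (indicator (X k -` S h \<inter> space \<Omega>))"
      using eq by (intro Bochner_Integration.integral_cong) auto
    also have "\<dots> = prob (X k -` S h \<inter> space \<Omega>)" using ev by simp
    finally show "expectation (\<lambda>\<omega>. indicator (S h) (X k \<omega>)) = p h"
      using mass[OF that(2,1)] by simp
    have "integrable \<Omega> (indicator (X k -` S h \<inter> space \<Omega>) :: _ \<Rightarrow> real)"
      using ev by (intro integrable_real_indicator) (auto simp: emeasure_eq_measure)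
    then show "integrable \<Omega> (\<lambda>\<omega>. indicator (S h) (X k \<omega>) :: real)"
      using eq by (subst Bochner_Integration.integrable_cong[OF refl eq]) auto
  qed
  have "expectation (\<lambda>\<omega>. class_score i j (X k \<omega>)) = 2 * p i - p j - p 0" if "k \<in> {1..n}" for k
    unfolding class_score_def using ind[OF ij(1) that] ind[OF ij(2) that] ind[OF ij(3) that] by simp
  then have "of_nat (card {1..n}) * g \<le> \<mu>"
    unfolding \<mu>_def using gap[OF i j] by (intro sum_bounded_below) auto
  then have mu: "real n * g \<le> \<mu>" by simp
  have ng: "0 < real n * g" using n pos by simp
  have "prob {\<omega> \<in> space \<Omega>. (\<Sum>k\<in>{1..n}. class_score i j (X k \<omega>)) \<le> 0}
      \<le> exp (- 2 * \<mu>\<^sup>2 / (\<Sum>k\<in>{1..n}. (2 - -2)\<^sup>2))"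
    using H.Hoeffding_ineq_le[of \<mu>] mu ng n by (simp add: \<mu>_def)
  also have "\<dots> \<le> exp (- (g\<^sup>2 / 8 * real n))"
  proof -
    have "(real n * g)\<^sup>2 \<le> \<mu>\<^sup>2" using mu ng by (intro power_mono) auto
    then have "real n * (real n * g\<^sup>2) \<le> \<mu>\<^sup>2" by (simp add: power2_eq_square mult_ac)
    then have "real n * g\<^sup>2 \<le> \<mu>\<^sup>2 / real n" using n by (simp add: field_simps)
    then show ?thesis by (simp add: mult_ac)
  qed
  finally show "prob {\<omega> \<in> space \<Omega>. (\<Sum>k\<in>{1..n}. class_score i j (X k \<omega>)) \<le> 0}
      \<le> exp (- (g\<^sup>2 / 8 * real n))" .
qed

definition unbalanced :: "'w set" where
  "unbalanced = (\<Union>(i, j)\<in>{1..M} \<times> {1..M}.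
     {\<omega> \<in> space \<Omega>. (\<Sum>k\<in>{1..n}. class_score i j (X k \<omega>)) \<le> 0})"

lemma prob_unbalanced:
  "unbalanced \<in> events" "prob unbalanced \<le> (real M)\<^sup>2 * exp (- (g\<^sup>2 / 8 * real n))"
proof -
  let ?E = "\<lambda>(i, j). {\<omega> \<in> space \<Omega>. (\<Sum>k\<in>{1..n}. class_score i j (X k \<omega>)) \<le> 0}"
  show "unbalanced \<in> events"
    unfolding unbalanced_def using prob_class_score(1) by (intro sets.finite_UN) auto
  have "prob unbalanced \<le> (\<Sum>t\<in>{1..M} \<times> {1..M}. prob (?E t))"
    unfolding unbalanced_def using prob_class_score(1)
    by (intro finite_measure_subadditive_finite) auto
  also have "\<dots> \<le> of_nat (card ({1..M} \<times> {1..M})) * exp (- (g\<^sup>2 / 8 * real n))"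
    using prob_class_score(2) by (intro sum_bounded_above) auto
  finally show "prob unbalanced \<le> (real M)\<^sup>2 * exp (- (g\<^sup>2 / 8 * real n))"
    by (simp add: power2_eq_square)
qed

section \<open>The risk for a free mesh and chain length\<close>

text \<open>Each bad event guards one hypothesis of \<open>selected_radius_separates\<close> at
  radius \<open>4 * q\<close>: \<open>missed_ball\<close> guards \<open>connected_class\<close>, the
  chains guard \<open>separated\<close>, and \<open>unbalanced\<close> guards
  \<open>sizes\<close>.\<close>

lemma clustered_outside_bad_events:
  assumes q: "0 < q" "real m * (4 * q) < \<delta>" "1 \<le> m" and \<omega>: "\<omega> \<in> space \<Omega>"
    and C: "\<And>i. i \<in> {1..M} \<Longrightarrow> finite (C i)" "\<And>i. i \<in> {1..M} \<Longrightarrow> S i \<subseteq> (\<Union>z\<in>C i. ball z q)"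
    and good: "\<omega> \<notin> missed_ball C q" "\<omega> \<notin> (\<Union>t\<in>chain_index m (4 * q). chain_event m (4 * q) t)"
      "\<omega> \<notin> unbalanced"
  shows "\<exists>\<pi>. \<pi> permutes {1..M} \<and> (\<forall>i\<in>{1..M}. {k \<in> {1..n}. X k \<omega> \<in> S i}
      \<subseteq> ranked_cluster n (\<lambda>k. X k \<omega>) (selected_radius n M (\<lambda>k. X k \<omega>)) (\<pi> i))"
proof -
  define I where "I i = {k \<in> {1..n}. X k \<omega> \<in> S i}" for i
  let ?x = "\<lambda>k. X k \<omega>"
  have cover: "{1..n} = (\<Union>i\<in>{0..M}. I i)"
  proof
    show "{1..n} \<subseteq> (\<Union>i\<in>{0..M}. I i)"
    proof
      fix k assume k: "k \<in> {1..n}"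
      have "X k \<omega> \<in> (\<Union>i\<in>{0..M}. S i)" using cube[OF k \<omega>] S_cover by blast
      then show "k \<in> (\<Union>i\<in>{0..M}. I i)" using k by (auto simp: I_def)
    qed
  qed (auto simp: I_def)
  show ?thesis
  proof (rule selected_radius_separates[OF M _ cover, of "4 * q" ?x])
    show "0 \<le> 4 * q" using q by simp
    show "(k, l) \<in> (neighbour_graph n ?x (4 * q))\<^sup>*"
      if i: "i \<in> {1..M}" and kl: "k \<in> I i" "l \<in> I i" for i k l
    proof (rule neighbour_graph_connects_net[OF S_connected[OF i] C(1)[OF i] C(2)[OF i]])
      show "\<exists>k\<in>{1..n}. X k \<omega> \<in> ball z q" if "z \<in> C i" for z
        using good(1) i that \<omega> unfolding missed_ball_def by blast
    qed (use kl in \<open>auto simp: I_def\<close>)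
    show "i = j" if ij: "i \<in> {1..M}" "j \<in> {1..M}" and kl: "k \<in> I i" "l \<in> I j"
      and path: "(k, l) \<in> (neighbour_graph n ?x (4 * q))\<^sup>*" for i j k l
    proof (rule ccontr)
      assume ne: "i \<noteq> j"
      have far: "\<delta> \<le> norm (?x k - ?x l)"
        if "i \<in> {1..M}" "j \<in> {1..M}" "i \<noteq> j" "k \<in> I i" "l \<in> I j" for i j k l
        using S_far[OF that(1-3), of "?x k" "?x l"] that(4,5) by (simp add: I_def dist_norm)
      obtain f where f: "inj_on f {..<m}" "\<And>j. j < m \<Longrightarrow> f j \<in> I 0 \<inter> {1..n}"
          "\<And>j. Suc j < m \<Longrightarrow> norm (?x (f j) - ?x (f (Suc j))) \<le> 4 * q"
        using outlier_chain[where n = n and M = M and I = I and \<delta> = \<delta> and x = ?x and i = i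
            and j = j and k = k and l = l and \<rho> = "4 * q" and m = m] cover far ij ne kl path q by auto
      have "\<omega> \<in> (\<Union>t\<in>chain_index m (4 * q). chain_event m (4 * q) t)"
        by (rule chain_in_chain_event[of "4 * q" \<omega> m f]) (use f q \<omega> in \<open>auto simp: I_def\<close>)
      then show False using good(2) by blast
    qed
    show "card (I j) + card (I 0) < 2 * card (I i)" if ij: "i \<in> {1..M}" "j \<in> {1..M}" for i j
    proof -
      have "0 < (\<Sum>k\<in>{1..n}. class_score i j (?x k))"
        using good(3) ij \<omega> unfolding unbalanced_def by (auto simp: not_le)
      also have "\<dots> = 2 * real (card (I i)) - real (card (I j)) - real (card (I 0))"
        unfolding class_score_def sum_subtractf sum_distrib_left[symmetric] sum_indicator_card I_def
        by simp
      finally show ?thesis by linarith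
    qed
    show ?thesis if "\<pi> permutes {1..M}"
      "\<And>i. i \<in> {1..M} \<Longrightarrow> I i \<subseteq> ranked_cluster n ?x (selected_radius n M ?x) (\<pi> i)" for \<pi>
      using that unfolding I_def by blast
  qed
qed

text \<open>\<open>q\<close> and \<open>m\<close> stay free for the later optimisation. The
  condition \<open>real m * (4 * q) < \<delta>\<close> forces every link between two supports to
  contain a chain of \<open>m\<close> outliers.\<close>

theorem clustering_risk_le:
  assumes q: "0 < q" "q \<le> r1" "4 * q \<le> 1" "real m * (4 * q) < \<delta>" "1 \<le> m"
  shows "clustering_risk \<Omega> X n M S (\<lambda>\<omega>. selected_radius n M (\<lambda>k. X k \<omega>))
    \<le> real M * (1 / (c * (q / 2) powr d)) * exp (- (real n * (c * q powr d)))
      + (2 / (4 * q)) ^ CARD('d) * (3 ^ CARD('d) * K * (real n * \<epsilon> * (4 * q) ^ CARD('d))) ^ m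
      + (real M)\<^sup>2 * exp (- (g\<^sup>2 / 8 * real n))"
proof -
  obtain C where C: "\<And>i. i \<in> {1..M} \<Longrightarrow> finite (C i)" "\<And>i. i \<in> {1..M} \<Longrightarrow> C i \<subseteq> S i"
    "\<And>i. i \<in> {1..M} \<Longrightarrow> S i \<subseteq> (\<Union>z\<in>C i. ball z q)"
    "\<And>i. i \<in> {1..M} \<Longrightarrow> real (card (C i)) \<le> 1 / (c * (q / 2) powr d)"
    using net_exists[OF q(1,2)] by blast
  let ?A = "missed_ball C q" and ?B = "\<Union>t\<in>chain_index m (4 * q). chain_event m (4 * q) t"
  have q4: "0 < 4 * q" using q by simp
  note a = prob_missed_ball[OF q(1,2) C(1,2,4)]
  note b = prob_chain[OF q4 q(3), of m]
  note u = prob_unbalanced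
  have "clustering_risk \<Omega> X n M S (\<lambda>\<omega>. selected_radius n M (\<lambda>k. X k \<omega>)) \<le> prob (?A \<union> ?B \<union> unbalanced)"
    unfolding clustering_risk_def
  \<comment> \<open>Measurability is established for the covering event only.\<close>
  proof (rule finite_measure_mono)
    show "?A \<union> ?B \<union> unbalanced \<in> events" using a(1) b(1) u(1) by auto
    show "{\<omega> \<in> space \<Omega>. \<forall>\<pi>. \<pi> permutes {1..M} \<longrightarrow> (\<exists>i\<in>{1..M}. \<not> {k \<in> {1..n}. X k \<omega> \<in> S i}
        \<subseteq> ranked_cluster n (\<lambda>k. X k \<omega>) (selected_radius n M (\<lambda>k. X k \<omega>)) (\<pi> i))}
        \<subseteq> ?A \<union> ?B \<union> unbalanced"
    proof
      fix \<omega> assume \<omega>: "\<omega> \<in> {\<omega> \<in> space \<Omega>. \<forall>\<pi>. \<pi> permutes {1..M} \<longrightarrow> (\<exists>i\<in>{1..M}.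
        \<not> {k \<in> {1..n}. X k \<omega> \<in> S i}
        \<subseteq> ranked_cluster n (\<lambda>k. X k \<omega>) (selected_radius n M (\<lambda>k. X k \<omega>)) (\<pi> i))}"
      show "\<omega> \<in> ?A \<union> ?B \<union> unbalanced"
      proof (rule ccontr)
        assume "\<omega> \<notin> ?A \<union> ?B \<union> unbalanced"
        then show False
          using clustered_outside_bad_events[OF q(1,4,5) _ C(1,3), of \<omega>] \<omega> by blast
      qed
    qed
  qed
  also have "\<dots> \<le> prob (?A \<union> ?B) + prob unbalanced"
    using a(1) b(1) u(1) by (intro measure_Un_le) auto
  also have "prob (?A \<union> ?B) \<le> prob ?A + prob ?B"
    using a(1) b(1) by (intro measure_Un_le) auto
  finally show ?thesis using a(2) b(2) u(2) by linarith
qed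

end

section \<open>Choice of the radius\<close>

text \<open>The inequality x <= exp x at x = b / (k \<rho>), raised to the power \<open>k\<close>.
  It lets part of an exponential in 1 / \<rho> pay for the polynomial number of starting
  cells.\<close>

lemma inverse_power_le_exp:
  fixes b \<rho> :: real
  assumes "0 < b" "0 < \<rho>" "0 < k"
  shows "(1 / \<rho>) ^ k \<le> (real k / b) ^ k * exp (b / \<rho>)"
proof -
  have "b / (real k * \<rho>) \<le> exp (b / (real k * \<rho>))"
    using exp_ge_add_one_self[of "b / (real k * \<rho>)"] by linarith
  then have "(b / (real k * \<rho>)) ^ k \<le> exp (b / (real k * \<rho>)) ^ k"
    using assms by (intro power_mono) auto
  also have "\<dots> = exp (b / \<rho>)" using assms(3) by (simp flip: exp_of_nat_mult)
  finally have "(real k / b) ^ k * (b / (real k * \<rho>)) ^ k \<le> (real k / b) ^ k * exp (b / \<rho>)"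
    using assms(1) by (intro mult_left_mono) auto
  moreover have "(real k / b) * (b / (real k * \<rho>)) = 1 / \<rho>" using assms by simp
  ultimately show ?thesis by (simp only: power_mult_distrib[symmetric])
qed

text \<open>
  The radius of the graph is \<open>4 * q = \<rho>0 / y\<close> for a small constant \<open>\<rho>0\<close>. The first bound takes
  \<open>y = 1\<close> and chains of a single outlier; the second takes chains of length of order \<open>y\<close>, for which
  \<open>\<rho>0\<close> makes the base of the \<open>m\<close>-th power at most \<open>exp (- 1)\<close>.
\<close>

lemma risk_rate:
  fixes M c d r1 \<delta> K g :: real and D :: nat
  assumes pos: "0 < M" "0 < c" "0 \<le> d" "0 < r1" "0 < \<delta>" "0 \<le> K" "0 < g" "0 < D"
  obtains C1 C2 :: real where "0 < C1" "0 < C2"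
    "\<And>(n::nat) \<epsilon> R. 1 \<le> n \<Longrightarrow> 0 \<le> \<epsilon> \<Longrightarrow>
      (\<forall>q m. 0 < q \<and> q \<le> r1 \<and> 4 * q \<le> 1 \<and> real m * (4 * q) < \<delta> \<and> 1 \<le> m \<longrightarrow>
        R \<le> M * (1 / (c * (q / 2) powr d)) * exp (- (real n * (c * q powr d)))
          + (2 / (4 * q)) ^ D * (3 ^ D * K * (real n * \<epsilon> * (4 * q) ^ D)) ^ m
          + M\<^sup>2 * exp (- (g\<^sup>2 / 8 * real n))) \<Longrightarrow>
      R \<le> C1 * (exp (- C2 * real n) + real n * \<epsilon>) \<and>
      (\<forall>y\<ge>1. real n * \<epsilon> \<le> y ^ D \<longrightarrow> real n * y powr (- d) \<le> y \<longrightarrow>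
        R \<le> C1 * y powr d * exp (- C2 * (real n * y powr (- d))))"
proof -
  define L where "L = 3 ^ D * K"
  \<comment> \<open>With \<open>4 * q = \<rho>0 / y\<close> and \<open>y \<ge> 1\<close>, the first
    two bounds secure \<open>4 * q \<le> 1\<close> and \<open>q \<le> r1\<close>, and the third
    leaves room for a chain of length at least 1. The last gives
    \<open>L * \<rho>0 ^ D \<le> exp (- 1)\<close>; the summand 1 in \<open>L + 1\<close> covers
    \<open>L = 0\<close>.\<close>
  define \<rho>0 where "\<rho>0 = min (min 1 (4 * r1)) (min (\<delta> / 4) (exp (- 1) / (L + 1)))"
  have L: "0 \<le> L" using pos by (simp add: L_def)
  have \<rho>0: "0 < \<rho>0" "\<rho>0 \<le> 1" "\<rho>0 \<le> 4 * r1" "\<rho>0 \<le> \<delta> / 4" "\<rho>0 \<le> exp (- 1) / (L + 1)"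
    using pos L by (simp add: \<rho>0_def) (unfold \<rho>0_def, linarith+)
  have L\<rho>0: "L * \<rho>0 ^ D \<le> exp (- 1)"
  proof -
    have "\<rho>0 ^ D \<le> \<rho>0 ^ 1" using \<rho>0 pos(8) by (intro power_decreasing) auto
    then have "L * \<rho>0 ^ D \<le> (L + 1) * \<rho>0" using L \<rho>0 by (intro mult_mono) auto
    also have "\<dots> \<le> (L + 1) * (exp (- 1) / (L + 1))" using L \<rho>0(5) by (intro mult_left_mono) auto
    also have "\<dots> = exp (- 1)" using L by simp
    finally show ?thesis .
  qed
  define a1 where "a1 = c * (\<rho>0 / 4) powr d"
  define A1 where "A1 = M * (1 / (c * (\<rho>0 / 8) powr d))"
  \<comment> \<open>The chain term decays like exp (- \<delta> / (4 \<rho>)). Half of this exponent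
    absorbs the powers of 1 / \<rho>, and the other half, b / \<rho>, remains.\<close>
  define b where "b = \<delta> / 8"
  define A2 where "A2 = 2 ^ D * (real D / b) ^ D"
  define C2 where "C2 = min (min a1 b) (g\<^sup>2 / 8)"
  define C1 where "C1 = A1 + A2 + M\<^sup>2 + 2 ^ D * L"
  have b: "0 < b" using pos by (simp add: b_def)
  have A: "0 < A1" "0 \<le> A2" "0 < a1" using pos \<rho>0 b by (auto simp: A1_def A2_def a1_def)
  have C2: "0 < C2" "C2 \<le> a1" "C2 \<le> b" "C2 \<le> g\<^sup>2 / 8" using A b pos by (auto simp: C2_def)
  have C1: "0 < C1" using A L by (simp add: C1_def add_pos_nonneg)
  show thesis
  proof (rule that[OF C1 C2(1)])
    fix n :: nat and \<epsilon> R :: real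
    assume n: "1 \<le> n" and \<epsilon>: "0 \<le> \<epsilon>" and
      bound: "\<forall>q m. 0 < q \<and> q \<le> r1 \<and> 4 * q \<le> 1 \<and> real m * (4 * q) < \<delta> \<and> 1 \<le> m \<longrightarrow>
        R \<le> M * (1 / (c * (q / 2) powr d)) * exp (- (real n * (c * q powr d)))
          + (2 / (4 * q)) ^ D * (3 ^ D * K * (real n * \<epsilon> * (4 * q) ^ D)) ^ m
          + M\<^sup>2 * exp (- (g\<^sup>2 / 8 * real n))"
    have scaled: "R \<le> A1 * y powr d * exp (- (a1 * (real n * y powr (- d))))
          + (2 / (\<rho>0 / y)) ^ D * (L * (real n * \<epsilon> * (\<rho>0 / y) ^ D)) ^ m
          + M\<^sup>2 * exp (- (g\<^sup>2 / 8 * real n))"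
      if y: "1 \<le> y" and m: "real m * (\<rho>0 / y) < \<delta>" "1 \<le> m" for y m
    proof -
      have le: "\<rho>0 / y \<le> \<rho>0" using y \<rho>0 by (simp add: divide_le_eq mult_le_cancel_left1)
      have e: "\<rho>0 / y / 8 = (\<rho>0 / 8) / y" "\<rho>0 / y / 4 = (\<rho>0 / 4) / y" by auto
      have p1: "M * (1 / (c * (\<rho>0 / y / 8) powr d)) = A1 * y powr d"
        unfolding e A1_def using y \<rho>0 by (subst powr_divide) auto
      have p2: "real n * (c * (\<rho>0 / y / 4) powr d) = a1 * (real n * y powr (- d))"
        unfolding e a1_def using y \<rho>0 by (subst powr_divide) (auto simp: powr_minus_divide)
      have "R \<le> M * (1 / (c * (\<rho>0 / y / 4 / 2) powr d)) * exp (- (real n * (c * (\<rho>0 / y / 4) powr d)))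
          + (2 / (4 * (\<rho>0 / y / 4))) ^ D * (3 ^ D * K * (real n * \<epsilon> * (4 * (\<rho>0 / y / 4)) ^ D)) ^ m
          + M\<^sup>2 * exp (- (g\<^sup>2 / 8 * real n))"
        by (rule bound[rule_format]) (use y \<rho>0 le m in auto)
      also have "\<rho>0 / y / 4 / 2 = \<rho>0 / y / 8" by simp
      also have "4 * (\<rho>0 / y / 4) = \<rho>0 / y" by simp
      finally show ?thesis unfolding p1 p2 L_def .
    qed
    \<comment> \<open>The size term decays exponentially in \<open>n\<close>, hence also at any
      slower rate \<open>t \<le> n\<close>.\<close>
    have tail: "M\<^sup>2 * exp (- (g\<^sup>2 / 8 * real n)) \<le> M\<^sup>2 * exp (- C2 * t)" if "t \<le> real n" "0 \<le> t" for t
    proof -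
      have "C2 * t \<le> g\<^sup>2 / 8 * real n" using C2 that by (intro mult_mono) auto
      then show ?thesis by (intro mult_left_mono) auto
    qed
    show "R \<le> C1 * (exp (- C2 * real n) + real n * \<epsilon>) \<and>
      (\<forall>y\<ge>1. real n * \<epsilon> \<le> y ^ D \<longrightarrow> real n * y powr (- d) \<le> y \<longrightarrow>
        R \<le> C1 * y powr d * exp (- C2 * (real n * y powr (- d))))"
    proof (intro conjI allI impI)
      \<comment> \<open>For \<open>y = 1\<close> and \<open>m = 1\<close> the powers of
        \<open>\<rho>0\<close> cancel and the chain term becomes linear in
        \<open>n * \<epsilon>\<close>.\<close>
      have "R \<le> A1 * exp (- (a1 * real n)) + (2 / \<rho>0) ^ D * (L * (real n * \<epsilon> * \<rho>0 ^ D))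
          + M\<^sup>2 * exp (- (g\<^sup>2 / 8 * real n))"
        using scaled[of 1 1] \<rho>0 pos by simp
      also have "(2 / \<rho>0) ^ D * (L * (real n * \<epsilon> * \<rho>0 ^ D)) = 2 ^ D * L * (real n * \<epsilon>)"
        using \<rho>0 by (simp add: power_divide)
      also have "A1 * exp (- (a1 * real n)) \<le> A1 * exp (- C2 * real n)"
        using A C2 by (intro mult_left_mono) (auto intro: mult_right_mono)
      also note tail[of "real n"]
      finally have "R \<le> A1 * exp (- C2 * real n) + 2 ^ D * L * (real n * \<epsilon>)
          + M\<^sup>2 * exp (- C2 * real n)" by simp
      also have "\<dots> \<le> C1 * exp (- C2 * real n) + C1 * (real n * \<epsilon>)"
      proof -
        have "(A1 + M\<^sup>2) * exp (- C2 * real n) \<le> C1 * exp (- C2 * real n)"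
          using A L by (intro mult_right_mono) (auto simp: C1_def)
        moreover have "2 ^ D * L * (real n * \<epsilon>) \<le> C1 * (real n * \<epsilon>)"
          using A L \<epsilon> by (intro mult_right_mono) (auto simp: C1_def)
        ultimately show ?thesis by (simp add: distrib_right)
      qed
      finally show "R \<le> C1 * (exp (- C2 * real n) + real n * \<epsilon>)" by (simp add: distrib_left)
    next
      fix y :: real
      assume y: "1 \<le> y" and few: "real n * \<epsilon> \<le> y ^ D" and le_y: "real n * y powr (- d) \<le> y"
      define t where "t = real n * y powr (- d)"
      define \<rho> where "\<rho> = \<rho>0 / y"
      \<comment> \<open>Rounding down loses at most 1, and 1 <= \<delta> / (4 \<rho>), so
        \<open>m\<close> lies between \<delta> / (4 \<rho>) and \<delta> / (2 \<rho>). The lower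
        bound gives the decay, the upper one keeps m \<rho> below \<delta>.\<close>
      define m where "m = nat \<lfloor>\<delta> / (2 * \<rho>)\<rfloor>"
      have t: "0 \<le> t" "t \<le> y" using le_y by (auto simp: t_def)
      have "y powr (- d) \<le> y powr 0" using y pos by (intro powr_mono) auto
      then have tn: "t \<le> real n"
        unfolding t_def using y by (simp add: mult_le_cancel_left1 mult_left_le)
      have \<rho>: "0 < \<rho>" "\<rho> \<le> \<delta> / 4" "\<rho> \<le> 1 / y"
      proof -
        show "0 < \<rho>" using y \<rho>0 by (simp add: \<rho>_def)
        have "\<rho> \<le> \<rho>0" unfolding \<rho>_def using y \<rho>0 by (simp add: divide_le_eq mult_le_cancel_left1)
        then show "\<rho> \<le> \<delta> / 4" using \<rho>0 by simp
        show "\<rho> \<le> 1 / y" unfolding \<rho>_def using y \<rho>0 by (intro divide_right_mono) auto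
      qed
      have r2: "1 \<le> \<delta> / (4 * \<rho>)" using \<rho> by (simp add: field_simps)
      have half: "\<delta> / (2 * \<rho>) = \<delta> / (4 * \<rho>) + \<delta> / (4 * \<rho>)" using \<rho> by (simp add: field_simps)
      have m1: "real m \<le> \<delta> / (2 * \<rho>)" unfolding m_def using r2 half by simp
      have m2: "\<delta> / (4 * \<rho>) \<le> real m" unfolding m_def using r2 half by linarith
      have m3: "real m * \<rho> < \<delta>"
      proof -
        have "real m * \<rho> \<le> \<delta> / (2 * \<rho>) * \<rho>" using m1 \<rho> by (intro mult_right_mono) auto
        also have "\<dots> < \<delta>" using \<rho> pos by simp
        finally show ?thesis .
      qed
      have m4: "1 \<le> m" using m2 r2 by simp
      have "(2 / \<rho>) ^ D * (L * (real n * \<epsilon> * \<rho> ^ D)) ^ m \<le> A2 * exp (- C2 * t)"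
      proof -
        have "real n * \<epsilon> * \<rho> ^ D \<le> y ^ D * \<rho> ^ D" using few \<rho> by (intro mult_right_mono) auto
        also have "\<dots> = \<rho>0 ^ D" unfolding \<rho>_def using y by (simp add: power_divide)
        finally have "L * (real n * \<epsilon> * \<rho> ^ D) \<le> L * \<rho>0 ^ D" using L by (rule mult_left_mono)
        also note L\<rho>0
        finally have "(L * (real n * \<epsilon> * \<rho> ^ D)) ^ m \<le> exp (- 1) ^ m"
          using L \<epsilon> \<rho> by (intro power_mono) auto
        also have "\<dots> = exp (- real m)" by (simp flip: exp_of_nat_mult)
        also have "\<dots> \<le> exp (- (\<delta> / (4 * \<rho>)))" using m2 by simp
        finally have "(2 / \<rho>) ^ D * (L * (real n * \<epsilon> * \<rho> ^ D)) ^ m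
            \<le> (2 / \<rho>) ^ D * exp (- (\<delta> / (4 * \<rho>)))"
          using \<rho> by (intro mult_left_mono) auto
        also have "\<dots> = 2 ^ D * (1 / \<rho>) ^ D * exp (- (\<delta> / (4 * \<rho>)))"
          by (simp add: power_divide)
        also have "\<dots> \<le> 2 ^ D * ((real D / b) ^ D * exp (b / \<rho>)) * exp (- (\<delta> / (4 * \<rho>)))"
          using inverse_power_le_exp[OF b \<rho>(1) pos(8)]
          by (intro mult_right_mono mult_left_mono) auto
        also have "\<dots> = A2 * exp (- (b / \<rho>))"
        proof -
          have "b / \<rho> - \<delta> / (4 * \<rho>) = - (b / \<rho>)" using \<rho> by (simp add: b_def field_simps)
          then have "exp (b / \<rho>) * exp (- (\<delta> / (4 * \<rho>))) = exp (- (b / \<rho>))"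
            by (simp flip: exp_add)
          then show ?thesis by (simp add: A2_def mult.assoc)
        qed
        also have "\<dots> \<le> A2 * exp (- C2 * t)"
        proof -
          \<comment> \<open>The hypothesis \<open>real n * y powr (- d) \<le> y\<close> enters here
            as \<open>t \<le> y\<close>: the chain exponent, of order 1 / \<rho>, is at least of the
            order of the net exponent \<open>t\<close>.\<close>
          have "y \<le> 1 / \<rho>" using \<rho> y by (simp add: field_simps)
          then have "C2 * t \<le> b * (1 / \<rho>)" using C2 t b by (intro mult_mono) auto
          then show ?thesis using A by (intro mult_left_mono) auto
        qed
        finally show ?thesis .
      qed
      moreover have "A1 * y powr d * exp (- (a1 * t)) \<le> A1 * y powr d * exp (- C2 * t)"
        using A C2 t by (intro mult_left_mono) (auto intro: mult_right_mono)
      moreover note tail[OF tn t(1)]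
      moreover have "R \<le> A1 * y powr d * exp (- (a1 * t))
          + (2 / \<rho>) ^ D * (L * (real n * \<epsilon> * \<rho> ^ D)) ^ m + M\<^sup>2 * exp (- (g\<^sup>2 / 8 * real n))"
        using scaled[OF y _ m4] m3 by (simp add: \<rho>_def t_def)
      ultimately have "R \<le> (A1 * y powr d + A2 + M\<^sup>2) * exp (- C2 * t)"
        by (simp add: distrib_right)
      also have "\<dots> \<le> C1 * y powr d * exp (- C2 * t)"
      proof (intro mult_right_mono)
        have y1: "1 \<le> y powr d" using y pos by (simp add: ge_one_powr_ge_zero)
        have "(A2 + M\<^sup>2) * 1 \<le> (A2 + M\<^sup>2) * y powr d" using y1 A by (intro mult_left_mono) auto
        moreover have "0 \<le> 2 ^ D * L * y powr d" using L by simp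
        ultimately show "A1 * y powr d + A2 + M\<^sup>2 \<le> C1 * y powr d"
          by (simp add: C1_def distrib_right)
      qed simp
      finally show "R \<le> C1 * y powr d * exp (- C2 * (real n * y powr (- d)))" by (simp add: t_def)
    qed
  qed
qed

text \<open>
  The choices are \<open>y = n powr (1 / (d + 1))\<close>, which balances \<open>n * y powr (- d)\<close> and \<open>y\<close>, and
  \<open>y = n powr ((1 - \<beta>) / D)\<close>, the smallest \<open>y\<close> with \<open>n * \<epsilon> \<le> y ^ D\<close>.
\<close>

lemma risk_regimes:
  fixes C1 C2 d D \<epsilon> R :: real and n Dn :: nat
  assumes "1 \<le> n" "0 \<le> \<epsilon>" "\<epsilon> \<le> 1" "0 \<le> d" "D = real Dn" "0 < Dn" "0 < C1" "0 < C2"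
    and few: "R \<le> C1 * (exp (- C2 * real n) + real n * \<epsilon>)"
    and scale: "\<And>y. 1 \<le> y \<Longrightarrow> real n * \<epsilon> \<le> y ^ Dn \<Longrightarrow> real n * y powr (- d) \<le> y \<Longrightarrow>
        R \<le> C1 * y powr d * exp (- C2 * (real n * y powr (- d)))"
  defines "C \<equiv> 2 * C1" and "C' \<equiv> min C2 1"
  shows "\<epsilon> = exp (- real n) \<Longrightarrow> R \<le> C * real n * exp (- C' * real n)"
    and "d + 1 < D \<Longrightarrow> R \<le> C * real n * exp (- C' * real n powr (1 / (d + 1)))"
    and "d \<le> D \<Longrightarrow> D \<le> d + 1 \<Longrightarrow> \<epsilon> = real n powr (- \<beta>) \<Longrightarrow> 1 - D / (d + 1) \<le> \<beta> \<Longrightarrow>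
      R \<le> C * real n powr (d / (d + 1)) * exp (- C' * real n powr (1 / (d + 1)))"
    and "d \<le> D \<Longrightarrow> D \<le> d + 1 \<Longrightarrow> \<epsilon> = real n powr (- \<beta>) \<Longrightarrow> 0 < \<beta> \<Longrightarrow> \<beta> < 1 - D / (d + 1) \<Longrightarrow>
      R \<le> C * real n powr ((1 - \<beta>) * d / D) * exp (- C' * real n powr (1 + (\<beta> - 1) * d / D))"
proof -
  have n1: "1 \<le> real n" using assms(1) by simp
  \<comment> \<open>The factor 2 in \<open>C\<close> and the cap at 1 in \<open>C'\<close> serve the
    first regime, where a second term n exp (- n) with decay rate 1 is added.\<close>
  have C: "C1 \<le> C" "0 \<le> C" "0 < C'" "C' \<le> C2" "C' \<le> 1" using assms by (auto simp: C_def C'_def)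
  have weaken: "C1 * u * exp (- C2 * z) \<le> C * u * exp (- C' * z)" if "0 \<le> u" "0 \<le> z" for u z
    using C that by (intro mult_mono) (auto intro: mult_right_mono)
  show "R \<le> C * real n * exp (- C' * real n)" if \<epsilon>: "\<epsilon> = exp (- real n)"
  proof -
    have e: "exp (- C2 * real n) \<le> exp (- C' * real n)" "exp (- real n) \<le> exp (- C' * real n)"
      using C by (auto intro: mult_right_mono simp: mult_left_le_one_le)
    have "exp (- C2 * real n) \<le> real n * exp (- C' * real n)"
      using mult_mono[OF n1 e(1)] by simp
    moreover have "real n * exp (- real n) \<le> real n * exp (- C' * real n)"
      using e(2) by (intro mult_left_mono) auto
    ultimately have "C1 * (exp (- C2 * real n) + real n * \<epsilon>)
        \<le> C1 * (real n * exp (- C' * real n) + real n * exp (- C' * real n))"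
      unfolding \<epsilon> using mult_left_mono[OF add_mono] assms(7) by auto
    then show ?thesis using few by (simp add: C_def)
  qed
  \<comment> \<open>Shared by the second and third regimes: the bound on \<open>\<epsilon>\<close>
    says \<open>real n * \<epsilon> \<le> y ^ Dn\<close> for the balanced \<open>y\<close>.\<close>
  have small: "R \<le> C * real n powr (d / (d + 1)) * exp (- C' * real n powr (1 / (d + 1)))"
    if \<epsilon>: "\<epsilon> \<le> real n powr (D / (d + 1) - 1)"
  proof -
    define y where "y = real n powr (1 / (d + 1))"
    have y1: "1 \<le> y" unfolding y_def using n1 assms(4) by (intro ge_one_powr_ge_zero) auto
    have yD: "y ^ Dn = real n powr (D / (d + 1))"
      using n1 assms(5) by (simp add: y_def powr_powr flip: powr_realpow)
    have "real n * \<epsilon> \<le> real n * real n powr (D / (d + 1) - 1)" using \<epsilon> n1 by (intro mult_left_mono) auto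
    also have "\<dots> = y ^ Dn" unfolding yD using n1 by (simp add: powr_diff)
    finally have ny: "real n * \<epsilon> \<le> y ^ Dn" .
    have "real n * y powr (- d) = real n powr 1 * real n powr (- d / (d + 1))"
      using n1 by (simp add: y_def powr_powr)
    also have "\<dots> = real n powr (1 + - d / (d + 1))" by (rule powr_add[symmetric])
    also have "1 + - d / (d + 1) = 1 / (d + 1)" using assms(4) by (simp add: field_simps)
    finally have z: "real n * y powr (- d) = y" by (simp add: y_def)
    have yd: "y powr d = real n powr (d / (d + 1))" by (simp add: y_def powr_powr)
    have "R \<le> C1 * y powr d * exp (- C2 * y)" using scale[OF y1 ny] z by simp
    also have "\<dots> \<le> C * y powr d * exp (- C' * y)" using y1 by (intro weaken) auto
    finally show ?thesis unfolding yd by (simp add: y_def)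
  qed
  show "R \<le> C * real n * exp (- C' * real n powr (1 / (d + 1)))" if D: "d + 1 < D"
  proof -
    \<comment> \<open>The exponent in the condition of \<open>small\<close> is nonnegative here, so
      the condition holds for every \<open>\<epsilon> \<le> 1\<close>.\<close>
    have "1 \<le> D / (d + 1)" using D assms(4) by simp
    then have "1 \<le> real n powr (D / (d + 1) - 1)" using n1 by (intro ge_one_powr_ge_zero) auto
    then have "R \<le> C * real n powr (d / (d + 1)) * exp (- C' * real n powr (1 / (d + 1)))"
      using small assms(3) by simp
    also have "real n powr (d / (d + 1)) \<le> real n powr 1"
      using n1 assms(4) by (intro powr_mono) auto
    finally show ?thesis using C n1 by (simp add: mult_left_mono mult_right_mono)
  qed
  show "R \<le> C * real n powr (d / (d + 1)) * exp (- C' * real n powr (1 / (d + 1)))"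
    if "\<epsilon> = real n powr (- \<beta>)" "1 - D / (d + 1) \<le> \<beta>"
    by (rule small) (use that n1 in \<open>auto intro: powr_mono\<close>)
  show "R \<le> C * real n powr ((1 - \<beta>) * d / D) * exp (- C' * real n powr (1 + (\<beta> - 1) * d / D))"
    if \<epsilon>: "\<epsilon> = real n powr (- \<beta>)" and \<beta>: "\<beta> < 1 - D / (d + 1)"
  proof -
    have D: "0 < D" using assms by simp
    define y where "y = real n powr ((1 - \<beta>) / D)"
    have \<beta>1: "D / (d + 1) < 1 - \<beta>" using \<beta> by simp
    have \<beta>0: "0 < 1 - \<beta>"
      using \<beta>1 D assms(4) by (smt (verit) divide_pos_pos)
    have y1: "1 \<le> y" unfolding y_def using n1 \<beta>0 D by (intro ge_one_powr_ge_zero) auto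
    have "y ^ Dn = y powr D" using y1 assms(5) by (simp add: powr_realpow)
    also have "\<dots> = real n powr (1 - \<beta>)" using D by (simp add: y_def powr_powr)
    also have "\<dots> = real n * \<epsilon>" using n1 by (simp add: \<epsilon> powr_diff powr_minus divide_inverse)
    finally have ny: "real n * \<epsilon> \<le> y ^ Dn" by simp
    have "real n * y powr (- d) = real n powr 1 * real n powr ((1 - \<beta>) / D * - d)"
      using n1 by (simp add: y_def powr_powr)
    also have "\<dots> = real n powr (1 + (1 - \<beta>) / D * - d)" by (rule powr_add[symmetric])
    also have "1 + (1 - \<beta>) / D * - d = 1 + (\<beta> - 1) * d / D" using D by (simp add: field_simps)
    finally have z: "real n * y powr (- d) = real n powr (1 + (\<beta> - 1) * d / D)" .
    \<comment> \<open>The bound on \<open>\<beta>\<close> places the exponent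
      \<open>(1 - \<beta>) / D\<close> of \<open>y\<close> above the balanced value
      \<open>1 / (d + 1)\<close>, and from there on
      \<open>real n * y powr (- d) \<le> y\<close>.\<close>
    have "D \<le> (1 - \<beta>) * (d + 1)" using \<beta>1 assms(4) by (simp add: divide_less_eq)
    then have "1 \<le> (1 - \<beta>) * (d + 1) / D" using D by simp
    moreover have "(1 - \<beta>) * (d + 1) / D = (1 - \<beta>) / D - (\<beta> - 1) * d / D"
      unfolding diff_divide_distrib[symmetric] by (simp add: algebra_simps)
    ultimately have "1 + (\<beta> - 1) * d / D \<le> (1 - \<beta>) / D" by linarith
    then have zy: "real n * y powr (- d) \<le> y"
      unfolding z unfolding y_def using n1 by (intro powr_mono) auto
    have yd: "y powr d = real n powr ((1 - \<beta>) * d / D)" by (simp add: y_def powr_powr)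
    have "R \<le> C1 * y powr d * exp (- C2 * (real n * y powr (- d)))" by (rule scale[OF y1 ny zy])
    also have "\<dots> \<le> C * y powr d * exp (- C' * (real n * y powr (- d)))" by (intro weaken) auto
    finally show ?thesis unfolding z yd .
  qed
qed

section \<open>The mixture model\<close>

lemma unit_cube_eq_cbox: "(unit_cube :: (real ^ 'd) set) = cbox (\<chi> i. 0) (\<chi> i. 1)"
  by (auto simp: unit_cube_def mem_box_cart)

lemma unit_cube_closed: "closed (unit_cube :: (real ^ 'd) set)"
  and unit_cube_bounded: "bounded (unit_cube :: (real ^ 'd) set)"
  unfolding unit_cube_eq_cbox by (auto simp: closed_cbox bounded_cbox)

lemma cube_distributionD:
  assumes "cube_distribution \<mu>"
  shows "prob_space \<mu>" "sets \<mu> = sets borel" "measure \<mu> unit_cube = 1" "space \<mu> = UNIV"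
  using assms sets_eq_imp_space_eq[of \<mu> borel] by (auto simp: cube_distribution_def)

lemma measure_compl_zero:
  assumes "prob_space \<mu>" "sets \<mu> = sets borel" "A \<in> sets borel" "measure \<mu> A = 1"
    "B \<in> sets borel" "A \<inter> B = {}"
  shows "measure \<mu> B = 0"
proof -
  interpret prob_space \<mu> by fact
  have "space \<mu> = UNIV" using sets_eq_imp_space_eq[OF assms(2)] by simp
  then have "prob (UNIV - A) = 0" using prob_compl[of A] assms by simp
  moreover have "prob B \<le> prob (UNIV - A)"
    using assms by (intro finite_measure_mono) auto
  ultimately show ?thesis using measure_nonneg[of \<mu> B] by linarith
qed

lemma measure_support_subset_cube:
  assumes "cube_distribution \<mu>"
  shows "measure_support \<mu> \<subseteq> unit_cube"
proof (rule ccontr)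
  note D = cube_distributionD[OF assms]
  interpret prob_space \<mu> by (rule D(1))
  assume "\<not> ?thesis"
  then obtain x where x: "x \<in> measure_support \<mu>" "x \<in> - unit_cube" by blast
  have "measure \<mu> (- unit_cube) = 0"
    using D borel_closed[OF unit_cube_closed] borel_comp[OF borel_closed[OF unit_cube_closed]]
    by (intro measure_compl_zero[of \<mu> unit_cube]) auto
  then have "emeasure \<mu> (- unit_cube) = 0" by (simp add: emeasure_eq_measure)
  moreover have "open (- unit_cube :: (real ^ 'a) set)" using unit_cube_closed by auto
  ultimately show False using x by (auto simp: measure_support_def)
qed

lemma hausdorff_measure_mono: "A \<subseteq> B \<Longrightarrow> hausdorff_measure s A \<le> hausdorff_measure s B"
  unfolding hausdorff_measure_def hausdorff_premeasure_def
  by (intro SUP_mono' INF_superset_mono) auto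

text \<open>
  If \<open>S\<close> is a single point then \<open>diameter S = 0\<close> and \<open>reg\<close> is void, but \<open>\<mu>\<close> is then a point mass.
\<close>

lemma lower_density_of_hausdorff:
  fixes \<mu> :: "'a::metric_space measure"
  assumes "prob_space \<mu>" "sets \<mu> = sets borel" "S \<in> sets borel" "bounded S" "measure \<mu> S = 1"
    and s: "0 \<le> s" "s \<le> d" and \<kappa>: "0 < \<kappa>" and \<kappa>c: "1 \<le> \<kappa>c"
    and dens: "\<And>A. A \<in> sets borel \<Longrightarrow> A \<subseteq> S \<Longrightarrow>
          ennreal (inverse \<kappa>) * hausdorff_measure s A \<le> emeasure \<mu> A"
    and reg: "\<And>x r. x \<in> S \<Longrightarrow> 0 < r \<Longrightarrow> r \<le> diameter S \<Longrightarrow> ennreal (inverse \<kappa>c)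
          \<le> hausdorff_measure s (S \<inter> ball x r) / ennreal (unit_ball_vol s * r powr s)"
  shows "\<exists>c>0. \<exists>r1>0. \<forall>x\<in>S. \<forall>r. 0 < r \<and> r \<le> r1 \<longrightarrow> c * r powr d \<le> measure \<mu> (S \<inter> ball x r)"
proof -
  interpret prob_space \<mu> by fact
  \<comment> \<open>Restricting to radii up to 1 allows the common exponent \<open>d\<close> for all
    supports.\<close>
  have pd: "r powr d \<le> r powr s" if "0 < r" "r \<le> 1" for r :: real
    using that s(2) by (simp add: powr_mono')
  show ?thesis
  proof (cases "diameter S = 0")
    case True
    have "1 * r powr d \<le> prob (S \<inter> ball x r)" if x: "x \<in> S" and r: "0 < r" "r \<le> 1" for x r
    proof -
      have "y = x" if "y \<in> S" for y
        using diameter_bounded_bound[OF assms(4) that x] True by simp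
      then have "S = {x}" using x by blast
      then have "S \<inter> ball x r = S" using r by simp
      moreover have "r powr d \<le> 1" using r s by (simp add: powr_le1)
      ultimately show ?thesis using assms(5) by simp
    qed
    then show ?thesis by (intro exI[of _ "1::real"] conjI) auto
  next
    case False
    then have diam: "0 < diameter S" using diameter_ge_0[OF assms(4)] by simp
    \<comment> \<open>Lower density of \<open>\<mu>\<close> against the Hausdorff measure, times the
      lower regularity constant of that measure on balls.\<close>
    define c where "c = inverse \<kappa> * (inverse \<kappa>c * unit_ball_vol s)"
    have c: "0 < c" using \<kappa> \<kappa>c s by (simp add: c_def)
    have "c * r powr d \<le> prob (S \<inter> ball x r)"
      if x: "x \<in> S" and r: "0 < r" "r \<le> min 1 (diameter S)" for x r
    proof -
      let ?v = "unit_ball_vol s * r powr s" and ?H = "hausdorff_measure s (S \<inter> ball x r)"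
      have v: "0 < ?v" using s r by simp
      have "ennreal (inverse \<kappa>c) \<le> ?H / ennreal ?v" using reg x r by simp
      then have "ennreal (inverse \<kappa>c) * ennreal ?v \<le> ?H / ennreal ?v * ennreal ?v"
        by (rule mult_right_mono) simp
      also have "\<dots> = ?H"
      proof -
        have "ennreal ?v \<noteq> 0" using v by (simp only: ennreal_eq_0_iff not_le)
        then show ?thesis by (simp add: ennreal_divide_times ennreal_divide_self)
      qed
      finally have "ennreal (inverse \<kappa>) * (ennreal (inverse \<kappa>c) * ennreal ?v) \<le> ennreal (inverse \<kappa>) * ?H"
        by (rule mult_left_mono) simp
      also have "\<dots> \<le> emeasure \<mu> (S \<inter> ball x r)" using assms(3) by (intro dens) auto
      finally have "ennreal (inverse \<kappa> * (inverse \<kappa>c * ?v)) \<le> ennreal (prob (S \<inter> ball x r))"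
        using v \<kappa> \<kappa>c by (simp add: emeasure_eq_measure ennreal_mult)
      then have "inverse \<kappa> * (inverse \<kappa>c * ?v) \<le> prob (S \<inter> ball x r)" by simp
      moreover have "c * r powr d \<le> c * r powr s" using pd r c by (intro mult_left_mono) auto
      ultimately show ?thesis by (simp add: c_def mult.assoc)
    qed
    then show ?thesis using c diam
      by (intro exI[of _ c] conjI exI[of _ "min 1 (diameter S)"]) auto
  qed
qed

text \<open>\<open>hausdorff_dim\<close> is a real infimum, unspecified for an empty set of
  exponents; the sign of the dimension is read off the covering numbers, whose ratio is nonnegative
  for \<open>r < 1\<close>.\<close>

lemma covering_rate_nonneg:
  assumes "((\<lambda>r. ln (real (covering_number r S)) / ln (1 / r)) \<longlongrightarrow> s) (at_right 0)"
  shows "0 \<le> s"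
proof (rule tendsto_lowerbound[OF assms])
  have "eventually (\<lambda>r::real. r \<in> {0<..<1}) (at_right 0)"
    by (rule eventually_at_right_real) simp
  then show "\<forall>\<^sub>F r in at_right 0. 0 \<le> ln (real (covering_number r S)) / ln (1 / r)"
  proof eventually_elim
    case (elim r)
    have "0 \<le> ln (real (covering_number r S))"
      by (cases "covering_number r S = 0") auto
    then show ?case using elim by simp
  qed
qed simp

text \<open>The components live on disjoint sets, so only the component \<open>j\<close> charges a
  subset of \<open>S j\<close>.\<close>

lemma mixture_prob_of_subset:
  assumes "\<And>i. i \<in> {0..M} \<Longrightarrow> prob_space (P i)" "\<And>i. i \<in> {0..M} \<Longrightarrow> sets (P i) = sets borel"
    "\<And>i. i \<in> {0..M} \<Longrightarrow> measure (P i) (S i) = 1" "\<And>i. i \<in> {0..M} \<Longrightarrow> S i \<in> sets borel"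
    "\<And>i j. i \<in> {0..M} \<Longrightarrow> j \<in> {0..M} \<Longrightarrow> i \<noteq> j \<Longrightarrow> S i \<inter> S j = {}"
    and A: "A \<in> sets borel" "j \<in> {0..M}" "A \<subseteq> S j"
  shows "mixture_prob \<epsilon> M \<gamma> P A = (if j = 0 then \<epsilon> else (1 - \<epsilon>) * \<gamma> j) * measure (P j) A"
proof -
  have zero: "measure (P i) A = 0" if "i \<in> {0..M}" "i \<noteq> j" for i
    using that A assms(5)[OF that(1) A(2) that(2)]
    by (intro measure_compl_zero[of "P i" "S i"] assms) auto
  have "(\<Sum>i=1..M. \<gamma> i * measure (P i) A) = (\<Sum>i=1..M. if i = j then \<gamma> j * measure (P j) A else 0)"
    using zero by (intro sum.cong) auto
  also have "\<dots> = (if j = 0 then 0 else \<gamma> j * measure (P j) A)" using A(2) by auto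
  finally show ?thesis using zero[of 0] by (auto simp: mixture_prob_def)
qed

lemma uniform_constants:
  fixes M :: nat
  assumes "\<And>i. i \<in> {1..M} \<Longrightarrow> \<exists>c>0. \<exists>r1>0. \<forall>x\<in>S i. \<forall>r. 0 < r \<and> r \<le> r1 \<longrightarrow> c * r powr d \<le> f i x r"
  obtains c r1 :: real where "0 < c" "0 < r1"
    "\<And>i x r. i \<in> {1..M} \<Longrightarrow> x \<in> S i \<Longrightarrow> 0 < r \<Longrightarrow> r \<le> r1 \<Longrightarrow> c * r powr d \<le> f i x r"
proof -
  obtain c r where cr: "\<And>i. i \<in> {1..M} \<Longrightarrow> 0 < c i" "\<And>i. i \<in> {1..M} \<Longrightarrow> 0 < r i"
    "\<And>i x t. i \<in> {1..M} \<Longrightarrow> x \<in> S i \<Longrightarrow> 0 < t \<Longrightarrow> t \<le> r i \<Longrightarrow> c i * t powr d \<le> f i x t"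
    using assms by metis
  define c0 where "c0 = Min (insert 1 (c ` {1..M}))"
  define r0 where "r0 = Min (insert 1 (r ` {1..M}))"
  have "0 < c0" "0 < r0" using cr by (auto simp: c0_def r0_def)
  moreover have "c0 * t powr d \<le> f i x t"
    if i: "i \<in> {1..M}" and x: "x \<in> S i" and t: "0 < t" "t \<le> r0" for i x t
  proof -
    have "c0 \<le> c i" unfolding c0_def using i by (intro Min_le) auto
    then have "c0 * t powr d \<le> c i * t powr d" by (intro mult_right_mono) auto
    moreover have "r0 \<le> r i" unfolding r0_def using i by (intro Min_le) auto
    ultimately show ?thesis using cr(3)[OF i x t(1)] t(2) by simp
  qed
  ultimately show ?thesis by (rule that)
qed

lemma setdist_Min_le_dist:
  fixes S :: "nat \<Rightarrow> 'a::euclidean_space set" and M :: nat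
  defines "\<delta> \<equiv> Min {setdist (S i) (S j) | i j. 1 \<le> i \<and> i < j \<and> j \<le> M}"
  assumes "i \<in> {1..M}" "j \<in> {1..M}" "i \<noteq> j" "x \<in> S i" "y \<in> S j"
  shows "\<delta> \<le> dist x y"
proof -
  let ?T = "{setdist (S i) (S j) | i j. 1 \<le> i \<and> i < j \<and> j \<le> M}"
  have fin: "finite ?T"
    by (rule finite_subset[of _ "(\<lambda>(i, j). setdist (S i) (S j)) ` ({1..M} \<times> {1..M})"]) auto
  have *: "\<delta> \<le> dist x y" if "i \<in> {1..M}" "j \<in> {1..M}" "i < j" "x \<in> S i" "y \<in> S j" for i j x y
  proof -
    have "\<delta> \<le> setdist (S i) (S j)" unfolding \<delta>_def using fin that by (intro Min_le) auto
    also have "\<dots> \<le> dist x y" using that by (intro setdist_le_dist) auto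
    finally show ?thesis .
  qed
  show ?thesis
    using *[of i j x y] *[of j i y x] assms(2-) by (cases "i < j") (auto simp: dist_commute)
qed

text \<open>At the threshold, 1 - \<epsilon> equals 1 / (1 + \<gamma>bar). As 2 a - b >= 2
  \<gamma>bar, the balance is at least 2 \<gamma>bar / (1 + \<gamma>bar) - \<epsilon>, and the same
  threshold leaves \<gamma>bar / (1 + \<gamma>bar), free of \<epsilon>.\<close>

lemma balance_gap:
  fixes \<gamma>min \<gamma>max \<gamma>bar \<epsilon> :: real
  assumes "\<gamma>bar = \<gamma>min - \<gamma>max / 2" "0 < \<gamma>bar" "0 \<le> \<epsilon>" "\<epsilon> < \<gamma>bar / (1 + \<gamma>bar)"
  shows "inverse (1 + \<gamma>bar) \<le> 1 - \<epsilon>"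
    and "a \<ge> \<gamma>min \<Longrightarrow> b \<le> \<gamma>max \<Longrightarrow> \<gamma>bar / (1 + \<gamma>bar) \<le> 2 * ((1 - \<epsilon>) * a) - (1 - \<epsilon>) * b - \<epsilon>"
proof -
  have "1 - \<gamma>bar / (1 + \<gamma>bar) = inverse (1 + \<gamma>bar)" using assms by (simp add: field_simps)
  then show 1: "inverse (1 + \<gamma>bar) \<le> 1 - \<epsilon>" using assms(4) by linarith
  assume ab: "\<gamma>min \<le> a" "b \<le> \<gamma>max"
  have e: "0 \<le> 1 - \<epsilon>" using 1 assms(2) by (smt (verit) inverse_positive_iff_positive)
  have "(1 - \<epsilon>) * (2 * \<gamma>bar) \<le> (1 - \<epsilon>) * (2 * a - b)"
    using e ab assms(1) by (intro mult_left_mono) auto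
  moreover have "\<gamma>bar * inverse (1 + \<gamma>bar) \<le> \<gamma>bar * (1 - \<epsilon>)"
    using 1 assms(2) by (intro mult_left_mono) auto
  moreover have "\<gamma>bar / (1 + \<gamma>bar) = \<gamma>bar * inverse (1 + \<gamma>bar)" by (simp add: divide_inverse)
  ultimately show "\<gamma>bar / (1 + \<gamma>bar) \<le> 2 * ((1 - \<epsilon>) * a) - (1 - \<epsilon>) * b - \<epsilon>"
    using assms(4) by (simp add: algebra_simps)
qed

theorem corollary2:
  fixes M :: nat
    and \<gamma> :: "nat \<Rightarrow> real"
    and P :: "nat \<Rightarrow> (real ^ 'd) measure"
    and S :: "nat \<Rightarrow> (real ^ 'd) set"
    and s :: "nat \<Rightarrow> real"
    and D d \<gamma>min \<gamma>max \<gamma>bar :: real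
  assumes "M \<ge> 2"
    and "\<And>i. i \<in> {1..M} \<Longrightarrow> 0 \<le> \<gamma> i" and "(\<Sum>i=1..M. \<gamma> i) = 1"
    and "\<And>i. i \<in> {0..M} \<Longrightarrow> cube_distribution (P i)"
    and "\<And>i. i \<in> {1..M} \<Longrightarrow> S i = measure_support (P i)"
    and "S 0 = unit_cube - (\<Union>i\<in>{1..M}. S i)"
    and "measure_support (P 0) \<subseteq> closure (S 0)"
    and "\<And>i. i \<in> {1..M} \<Longrightarrow> measure (P 0) (closure (S 0) \<inter> S i) = 0"
    and "D = real CARD('d)"
    and "\<And>i. i \<in> {1..M} \<Longrightarrow> s i = hausdorff_dim (S i)"
    and "d = Max (s ` {1..M})"
    and "\<gamma>min = Min (\<gamma> ` {1..M})" and "\<gamma>max = Max (\<gamma> ` {1..M})"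
    and "\<gamma>bar = \<gamma>min - \<gamma>max / 2"
    and "\<And>i. i \<in> {1..M} \<Longrightarrow> connected (S i)"
    and "Min {setdist (S i) (S j) | i j. 1 \<le> i \<and> i < j \<and> j \<le> M} > 0"
    and "\<exists>\<kappa>\<^sub>0>0. \<forall>A\<in>sets borel. A \<subseteq> S 0 \<longrightarrow>
           emeasure (P 0) A \<le> ennreal \<kappa>\<^sub>0 * hausdorff_measure D A"
    and "\<And>i. i \<in> {1..M} \<Longrightarrow> \<exists>\<kappa>>0. \<forall>A\<in>sets borel. A \<subseteq> S i \<longrightarrow>
           emeasure (P i) A \<ge> ennreal (inverse \<kappa>) * hausdorff_measure (s i) A"
    and "\<exists>\<kappa>c\<ge>1. \<forall>i\<in>{1..M}. \<forall>x\<in>S i. \<forall>r. 0 < r \<and> r \<le> diameter (S i) \<longrightarrow>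
           ennreal (inverse \<kappa>c)
             \<le> hausdorff_measure (s i) (S i \<inter> ball x r) / ennreal (unit_ball_vol (s i) * r powr s i) \<and>
           hausdorff_measure (s i) (S i \<inter> ball x r) / ennreal (unit_ball_vol (s i) * r powr s i)
             \<le> ennreal \<kappa>c"
    and "\<And>i. i \<in> {1..M} \<Longrightarrow>
           ((\<lambda>r. ln (real (covering_number r (S i))) / ln (1 / r)) \<longlongrightarrow> s i) (at_right 0)"
    and "\<gamma>max < 2 * \<gamma>min"
  shows "\<exists>C\<^sub>1>0. \<exists>C\<^sub>2>0. \<forall>n\<ge>M. \<forall>\<epsilon>. 0 \<le> \<epsilon> \<and> \<epsilon> < \<gamma>bar / (1 + \<gamma>bar) \<longrightarrow>
    (\<forall>(\<Omega> :: 'w measure) X. mixture_sample \<Omega> X n \<epsilon> M \<gamma> P \<longrightarrow>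
      (let R = clustering_risk \<Omega> X n M S (\<lambda>\<omega>. selected_radius n M (\<lambda>k. X k \<omega>)) in
        (\<epsilon> = exp (- real n) \<longrightarrow>
           R \<le> C\<^sub>1 * real n * exp (- C\<^sub>2 * real n)) \<and>
        (D > d + 1 \<longrightarrow>
           R \<le> C\<^sub>1 * real n * exp (- C\<^sub>2 * real n powr (1 / (d + 1)))) \<and>
        (\<forall>\<beta>. d \<le> D \<and> D \<le> d + 1 \<and> \<epsilon> = real n powr (- \<beta>) \<and> \<beta> \<ge> 1 - D / (d + 1) \<longrightarrow>
           R \<le> C\<^sub>1 * real n powr (d / (d + 1)) * exp (- C\<^sub>2 * real n powr (1 / (d + 1)))) \<and>
        (\<forall>\<beta>. d \<le> D \<and> D \<le> d + 1 \<and> \<epsilon> = real n powr (- \<beta>) \<and> 0 < \<beta> \<and> \<beta> < 1 - D / (d + 1) \<longrightarrow>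
           R \<le> C\<^sub>1 * real n powr ((1 - \<beta>) * d / D)
                 * exp (- C\<^sub>2 * real n powr (1 + (\<beta> - 1) * d / D)))))"
proof -
  define Dn where "Dn = CARD('d)"
  have Dn: "D = real Dn" "0 < Dn" using assms(9) by (simp_all add: Dn_def)
  note P = cube_distributionD[OF assms(4)]
  have in0: "i \<in> {0..M}" if "i \<in> {1..M}" for i using that by simp
  have S_eq: "S i = measure_support (P i)" if "i \<in> {1..M}" for i using assms(5)[OF that] .
  have S_closed: "closed (S i)" if "i \<in> {1..M}" for i
    using S_eq[OF that] measure_support_closed by simp
  have S_cube: "S i \<subseteq> unit_cube" if "i \<in> {1..M}" for i
    using S_eq[OF that] measure_support_subset_cube[OF assms(4)[OF in0[OF that]]] by simp
  have S_borel: "S i \<in> sets borel" if "i \<in> {0..M}" for i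
  proof (cases "i = 0")
    case True
    have "(\<Union>i\<in>{1..M}. S i) \<in> sets borel"
      using S_closed by (intro sets.finite_UN) auto
    then show ?thesis
      unfolding True assms(6) by (intro sets.Diff borel_closed[OF unit_cube_closed])
  next
    case False
    then show ?thesis using that borel_closed[OF S_closed[of i]] by simp
  qed
  define \<delta> where "\<delta> = Min {setdist (S i) (S j) | i j. 1 \<le> i \<and> i < j \<and> j \<le> M}"
  have \<delta>: "0 < \<delta>" using assms(16) by (simp add: \<delta>_def)
  have S_far: "\<delta> \<le> dist x y"
    if "i \<in> {1..M}" "j \<in> {1..M}" "i \<noteq> j" "x \<in> S i" "y \<in> S j" for i j x y
    unfolding \<delta>_def by (rule setdist_Min_le_dist[OF that])
  have S_disj: "S i \<inter> S j = {}" if "i \<in> {0..M}" "j \<in> {0..M}" "i \<noteq> j" for i j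
  proof (cases "i = 0 \<or> j = 0")
    case True
    then show ?thesis using that assms(6) by auto
  next
    case False
    then have "i \<in> {1..M}" "j \<in> {1..M}" using that by auto
    then show ?thesis using S_far[OF _ _ that(3)] \<delta> by (metis disjoint_iff dist_self not_less)
  qed
  have PS: "measure (P i) (S i) = 1" if i: "i \<in> {0..M}" for i
  proof (cases "i = 0")
    case False
    then show ?thesis using i S_eq[of i] measure_support_prob[OF P(1,2)[OF i]] by simp
  next
    case True
    \<comment> \<open>The outlier law has no mass off the closure of \<open>S 0\<close>, by the
      condition on its support, and none on \<open>S j\<close> inside this closure, by assumption.
      All its mass in the cube is thus on \<open>S 0\<close>.\<close>
    have z: "0 \<in> {0..M}" by simp
    interpret P0: prob_space "P 0" by (rule P(1)[OF z])
    note s0 = P(2)[OF z]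
    have cl: "measure (P 0) (- closure (S 0)) = 0"
      using measure_support_prob[OF P(1,2)[OF z]] assms(7) borel_closed[OF measure_support_closed]
      by (intro measure_compl_zero[OF P(1,2)[OF z], of "measure_support (P 0)"]) auto
    have null: "measure (P 0) (S j) = 0" if j: "j \<in> {1..M}" for j
    proof -
      have "measure (P 0) (S j) \<le> measure (P 0) ((closure (S 0) \<inter> S j) \<union> - closure (S 0))"
        using S_borel[OF in0[OF j]] s0 by (intro P0.finite_measure_mono) auto
      also have "\<dots> \<le> measure (P 0) (closure (S 0) \<inter> S j) + measure (P 0) (- closure (S 0))"
        using S_borel[OF in0[OF j]] s0 by (intro measure_Un_le) auto
      also have "\<dots> = 0" using assms(8)[OF j] cl by simp
      finally show ?thesis using measure_nonneg[of "P 0" "S j"] by linarith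
    qed
    have cover: "unit_cube \<subseteq> S 0 \<union> (\<Union>j\<in>{1..M}. S j)" using assms(6) by blast
    have "S 0 \<union> (\<Union>j\<in>{1..M}. S j) \<in> sets (P 0)"
      using S_borel s0 by (intro sets.Un sets.finite_UN) auto
    note mono = P0.finite_measure_mono[OF cover this]
    have "1 = measure (P 0) unit_cube" using P(3)[OF z] by simp
    also have "\<dots> \<le> measure (P 0) (S 0 \<union> (\<Union>j\<in>{1..M}. S j))"
      by (rule mono)
    also have "\<dots> \<le> measure (P 0) (S 0) + measure (P 0) (\<Union>j\<in>{1..M}. S j)"
      using S_borel s0 by (intro measure_Un_le sets.finite_UN) auto
    also have "measure (P 0) (\<Union>j\<in>{1..M}. S j) \<le> (\<Sum>j\<in>{1..M}. measure (P 0) (S j))"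
      using S_borel s0 by (intro P0.finite_measure_subadditive_finite) auto
    also have "\<dots> = 0" using null by simp
    finally show ?thesis using P0.prob_le_1[of "S 0"] True by simp
  qed
  have mix: "mixture_prob \<epsilon> M \<gamma> P A
      = (if j = 0 then \<epsilon> else (1 - \<epsilon>) * \<gamma> j) * measure (P j) A"
    if "A \<in> sets borel" "j \<in> {0..M}" "A \<subseteq> S j" for \<epsilon> A j
    by (rule mixture_prob_of_subset[of M P S]) (use P(1,2) PS S_borel S_disj that in blast)+
  have s: "0 \<le> s i" "s i \<le> d" if "i \<in> {1..M}" for i
  proof -
    show "0 \<le> s i" by (rule covering_rate_nonneg[OF assms(20)[OF that]])
    show "s i \<le> d" unfolding assms(11) using that by (intro Max_ge) auto
  qed
  have d: "0 \<le> d" using s[of 1] assms(1) by simp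
  obtain \<kappa>c where \<kappa>c: "1 \<le> \<kappa>c" and reg: "\<And>i x r. i \<in> {1..M} \<Longrightarrow> x \<in> S i \<Longrightarrow> 0 < r \<Longrightarrow>
      r \<le> diameter (S i) \<Longrightarrow> ennreal (inverse \<kappa>c)
        \<le> hausdorff_measure (s i) (S i \<inter> ball x r) / ennreal (unit_ball_vol (s i) * r powr s i)"
    using assms(19) by blast
  have "\<exists>c>0. \<exists>r1>0. \<forall>x\<in>S i. \<forall>r. 0 < r \<and> r \<le> r1 \<longrightarrow>
      c * r powr d \<le> measure (P i) (S i \<inter> ball x r)" if i: "i \<in> {1..M}" for i
  proof -
    obtain \<kappa> where \<kappa>: "0 < \<kappa>" "\<And>A. A \<in> sets borel \<Longrightarrow> A \<subseteq> S i \<Longrightarrow>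
        ennreal (inverse \<kappa>) * hausdorff_measure (s i) A \<le> emeasure (P i) A"
      using assms(18)[OF i] by blast
    show ?thesis
      by (rule lower_density_of_hausdorff[OF P(1,2)[OF in0[OF i]] S_borel[OF in0[OF i]]
            bounded_subset[OF unit_cube_bounded S_cube[OF i]] PS[OF in0[OF i]] s[OF i] \<kappa>(1) \<kappa>c \<kappa>(2)
            reg[OF i]])
  qed
  then obtain c r1 where c: "0 < c" "0 < r1" and dens: "\<And>i x r. i \<in> {1..M} \<Longrightarrow> x \<in> S i \<Longrightarrow>
      0 < r \<Longrightarrow> r \<le> r1 \<Longrightarrow> c * r powr d \<le> measure (P i) (S i \<inter> ball x r)"
    using uniform_constants[of M S d "\<lambda>i x r. measure (P i) (S i \<inter> ball x r)"] by blast
  obtain \<kappa>0 where \<kappa>0: "0 < \<kappa>0" "\<And>A. A \<in> sets borel \<Longrightarrow> A \<subseteq> S 0 \<Longrightarrow>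
      emeasure (P 0) A \<le> ennreal \<kappa>0 * hausdorff_measure D A"
    using assms(17) by blast
  \<comment> \<open>The density bound of the outliers times the constant of
    \<open>hausdorff_measure_grid_cell\<close>, with the power of \<rho> split off.\<close>
  define K where "K = \<kappa>0 * (unit_ball_vol D * (D / 2) ^ Dn)"
  have K: "0 \<le> K" using \<kappa>0 Dn by (simp add: K_def)
  have cell: "measure (P 0) (S 0 \<inter> grid_cell \<rho> v) \<le> K * \<rho> ^ Dn" if \<rho>: "0 < \<rho>" for \<rho> v
  proof -
    have z: "0 \<in> {0..M}" by simp
    interpret P0: prob_space "P 0" by (rule P(1)[OF z])
    have "emeasure (P 0) (S 0 \<inter> grid_cell \<rho> v)
        \<le> ennreal \<kappa>0 * hausdorff_measure D (S 0 \<inter> grid_cell \<rho> v)"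
      using S_borel[OF z] by (intro \<kappa>0(2)) auto
    also have "\<dots> \<le> ennreal \<kappa>0 * ennreal (unit_ball_vol D * (D * \<rho> / 2) ^ Dn)"
      using order_trans[OF hausdorff_measure_mono hausdorff_measure_grid_cell[OF \<rho>, of v]] Dn
      by (intro mult_left_mono) (auto simp: Dn_def)
    also have "\<dots> = ennreal (K * \<rho> ^ Dn)"
      using \<kappa>0 Dn \<rho> by (simp add: K_def power_mult_distrib power_divide mult_ac flip: ennreal_mult)
    finally show ?thesis using K \<rho> by (simp add: P0.emeasure_eq_measure)
  qed
  have \<gamma>: "\<gamma>min \<le> \<gamma> i" "\<gamma> i \<le> \<gamma>max" if "i \<in> {1..M}" for i
    using that by (auto simp: assms(12,13))
  have \<gamma>bar: "0 < \<gamma>bar" using assms(14,21) by simp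
  \<comment> \<open>This follows from \<open>\<gamma>min \<le> \<gamma> 1\<close>,
    \<open>\<gamma> 1 \<le> \<gamma>max\<close> and
    \<open>\<gamma>max < 2 * \<gamma>min\<close>.\<close>
  have \<gamma>min: "0 < \<gamma>min" using \<gamma>[of 1] assms(1,21) by simp
  \<comment> \<open>Both constants are free of \<open>\<epsilon>\<close>: \<open>balance_gap\<close>
    bounds the gap below by \<open>g\<close> and \<open>1 - \<epsilon>\<close> below by
    \<open>inverse (1 + \<gamma>bar)\<close> on the whole admissible range.\<close>
  define g where "g = \<gamma>bar / (1 + \<gamma>bar)"
  define c' where "c' = inverse (1 + \<gamma>bar) * \<gamma>min * c"
  have c': "0 < c'" "0 < g" using c \<gamma>bar \<gamma>min by (simp_all add: c'_def g_def)
  have M_pos: "0 < real M" using assms(1) by simp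
  obtain C1 C2 where C12: "0 < C1" "0 < C2" and rate: "\<And>(n::nat) \<epsilon> R. 1 \<le> n \<Longrightarrow> 0 \<le> \<epsilon> \<Longrightarrow>
      (\<forall>q m. 0 < q \<and> q \<le> r1 \<and> 4 * q \<le> 1 \<and> real m * (4 * q) < \<delta> \<and> 1 \<le> m \<longrightarrow>
        R \<le> real M * (1 / (c' * (q / 2) powr d)) * exp (- (real n * (c' * q powr d)))
          + (2 / (4 * q)) ^ Dn * (3 ^ Dn * K * (real n * \<epsilon> * (4 * q) ^ Dn)) ^ m
          + (real M)\<^sup>2 * exp (- (g\<^sup>2 / 8 * real n))) \<Longrightarrow>
      R \<le> C1 * (exp (- C2 * real n) + real n * \<epsilon>) \<and>
      (\<forall>y\<ge>1. real n * \<epsilon> \<le> y ^ Dn \<longrightarrow> real n * y powr (- d) \<le> y \<longrightarrow>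
        R \<le> C1 * y powr d * exp (- C2 * (real n * y powr (- d))))"
    using risk_rate[OF M_pos c'(1) d c(2) \<delta> K c'(2) Dn(2)] by blast
  \<comment> \<open>The witnesses are the constants \<open>C\<close> and \<open>C'\<close> of
    \<open>risk_regimes\<close>.\<close>
  show ?thesis
  proof (rule exI[of _ "2 * C1"], rule conjI, simp add: C12,
      rule exI[of _ "min C2 1"], rule conjI, simp add: C12, intro allI impI)
    fix n :: nat and \<epsilon> :: real and \<Omega> :: "'w measure" and X
    assume nM: "M \<le> n" and \<epsilon>: "0 \<le> \<epsilon> \<and> \<epsilon> < \<gamma>bar / (1 + \<gamma>bar)"
      and sample: "mixture_sample \<Omega> X n \<epsilon> M \<gamma> P"
    define R where "R = clustering_risk \<Omega> X n M S (\<lambda>\<omega>. selected_radius n M (\<lambda>k. X k \<omega>))"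
    note gap = balance_gap[OF assms(14) \<gamma>bar conjunct1[OF \<epsilon>] conjunct2[OF \<epsilon>]]
    have n: "1 \<le> n" using nM assms(1) by simp
    have "\<gamma>bar / (1 + \<gamma>bar) \<le> 1" using \<gamma>bar by simp
    then have \<epsilon>1: "\<epsilon> \<le> 1" using \<epsilon> by linarith
    define p where "p i = (if i = 0 then \<epsilon> else (1 - \<epsilon>) * \<gamma> i)" for i
    interpret prob_space \<Omega> using sample by (simp add: mixture_sample_def)
    have indep: "indep_vars (\<lambda>_. borel) X {1..n}" using sample by (simp add: mixture_sample_def)
    have law: "prob (X k -` A \<inter> space \<Omega>) = p j * measure (P j) A"
      if "k \<in> {1..n}" "A \<in> sets borel" "j \<in> {0..M}" "A \<subseteq> S j" for k A j
    proof -
      have "random_variable borel (X k)" using indep that(1) unfolding indep_vars_def by blast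
      then have "prob (X k -` A \<inter> space \<Omega>) = measure (distr \<Omega> borel (X k)) A"
        using that(2) by (simp add: measure_distr)
      also have "\<dots> = mixture_prob \<epsilon> M \<gamma> P A"
        using sample that by (simp add: mixture_sample_def)
      finally show ?thesis using mix[OF that(2-4)] by (simp add: p_def)
    qed
    interpret outlier_sample \<Omega> X n M S p d c' r1 \<delta> K \<epsilon> g
    proof unfold_locales
      show "X k \<omega> \<in> unit_cube" if "k \<in> {1..n}" "\<omega> \<in> space \<Omega>" for k \<omega>
        using sample that by (simp add: mixture_sample_def)
      show "unit_cube \<subseteq> (\<Union>i\<in>{0..M}. S i)"
      proof
        fix x :: "real ^ 'd" assume "x \<in> unit_cube"
        then have "x \<in> S 0 \<or> (\<exists>i\<in>{1..M}. x \<in> S i)" using assms(6) by blast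
        then show "x \<in> (\<Union>i\<in>{0..M}. S i)" by auto
      qed
      show "c' * r powr d \<le> prob (X k -` (S i \<inter> ball x r) \<inter> space \<Omega>)"
        if "k \<in> {1..n}" and i: "i \<in> {1..M}" and "x \<in> S i" "0 < r" "r \<le> r1" for k i x r
      proof -
        have i0: "i \<noteq> 0" using i by simp
        have "inverse (1 + \<gamma>bar) * \<gamma>min \<le> (1 - \<epsilon>) * \<gamma> i"
          using gap(1) \<gamma>(1)[OF i] \<gamma>bar \<gamma>min \<epsilon>1 by (intro mult_mono) auto
        then have "inverse (1 + \<gamma>bar) * \<gamma>min * (c * r powr d)
            \<le> (1 - \<epsilon>) * \<gamma> i * measure (P i) (S i \<inter> ball x r)"
          by (rule mult_mono) (use dens[OF i that(3-5)] c \<gamma>[OF i] \<gamma>min \<epsilon>1 in auto)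
        then show ?thesis
          using law[OF that(1) _ in0[OF i], of "S i \<inter> ball x r"] S_borel[OF in0[OF i]] i0
          by (simp add: p_def c'_def mult.assoc)
      qed
      show "prob (X k -` (S 0 \<inter> grid_cell \<rho> v) \<inter> space \<Omega>) \<le> \<epsilon> * K * \<rho> ^ CARD('d)"
        if "k \<in> {1..n}" "0 < \<rho>" for k \<rho> v
        using law[OF that(1), of "S 0 \<inter> grid_cell \<rho> v" 0] S_borel[of 0]
          mult_left_mono[OF cell[OF that(2), of v] conjunct1[OF \<epsilon>]]
        by (simp add: p_def Dn_def mult.assoc)
      show "prob (X k -` S i \<inter> space \<Omega>) = p i" if "k \<in> {1..n}" "i \<in> {0..M}" for k i
        using law[OF that(1) S_borel[OF that(2)] that(2)] PS[OF that(2)] by simp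
      show "g \<le> 2 * p i - p j - p 0" if "i \<in> {1..M}" "j \<in> {1..M}" for i j
        using gap(2)[OF \<gamma>(1)[OF that(1)] \<gamma>(2)[OF that(2)]] that by (simp add: p_def g_def)
    qed (use n assms(1,15) indep S_borel S_disj S_far c' \<epsilon> K in auto)
    have bounds: "R \<le> C1 * (exp (- C2 * real n) + real n * \<epsilon>) \<and>
      (\<forall>y\<ge>1. real n * \<epsilon> \<le> y ^ Dn \<longrightarrow> real n * y powr (- d) \<le> y \<longrightarrow>
        R \<le> C1 * y powr d * exp (- C2 * (real n * y powr (- d))))"
      using clustering_risk_le unfolding Dn_def[symmetric] R_def[symmetric]
      by (intro rate n conjunct1[OF \<epsilon>] allI impI) blast
    note reg = risk_regimes[OF n conjunct1[OF \<epsilon>] \<epsilon>1 d Dn C12 conjunct1[OF bounds]]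
    have scale: "R \<le> C1 * y powr d * exp (- C2 * (real n * y powr (- d)))"
      if "1 \<le> y" "real n * \<epsilon> \<le> y ^ Dn" "real n * y powr (- d) \<le> y" for y
      using bounds that by blast
    show "let R = clustering_risk \<Omega> X n M S (\<lambda>\<omega>. selected_radius n M (\<lambda>k. X k \<omega>)) in
        (\<epsilon> = exp (- real n) \<longrightarrow>
           R \<le> 2 * C1 * real n * exp (- min C2 1 * real n)) \<and>
        (D > d + 1 \<longrightarrow>
           R \<le> 2 * C1 * real n * exp (- min C2 1 * real n powr (1 / (d + 1)))) \<and>
        (\<forall>\<beta>. d \<le> D \<and> D \<le> d + 1 \<and> \<epsilon> = real n powr (- \<beta>) \<and> \<beta> \<ge> 1 - D / (d + 1) \<longrightarrow>
           R \<le> 2 * C1 * real n powr (d / (d + 1)) * exp (- min C2 1 * real n powr (1 / (d + 1)))) \<and>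
        (\<forall>\<beta>. d \<le> D \<and> D \<le> d + 1 \<and> \<epsilon> = real n powr (- \<beta>) \<and> 0 < \<beta> \<and> \<beta> < 1 - D / (d + 1) \<longrightarrow>
           R \<le> 2 * C1 * real n powr ((1 - \<beta>) * d / D)
                 * exp (- min C2 1 * real n powr (1 + (\<beta> - 1) * d / D)))"
      unfolding Let_def R_def[symmetric]
      using reg[OF scale] by blast
  qed
qed

end
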